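(* For all $p\in[1,\infty)$, $q\in(1,\infty)$, $M\in[1,\infty)$, $\delta>0$ and every positive integer $n$, there is a positive constant $C$ depending only on $p$, $q$, $n$, $\delta$ and $M$ such that the following holds. Let $\omega\in A_{M}^{q}(\mathbb{C}^{n})$, let $\Omega\subset\mathbb{C}^{n}$ be a $\delta$-John domain, and let $f=h+\overline{g}$ be a pluriharmonic function in $\Omega$, where $h,g\in L^{p}(\Omega,\omega)$ are holomorphic in $\Omega$. Then $$\|h-h_{\Omega,\omega}\|_{p,\Omega,\omega}+\|g-g_{\Omega,\omega}\|_{p,\Omega,\omega}\leq C\|f\|_{p,\Omega,\omega}.$$
   Context: $\mathbb{C}^n$ is identified with $\mathbb{R}^{2n}$; $d\mu$ is Lebesgue measure and $|Q|$ is the Lebesgue measure of $Q$. A twice continuously differentiable complex-valued function $f$ is pluriharmonic if $\partial^2 f/\partial z_j\partial\overline{z}_k=0$ for all $j,k$. John domain: a proper subdomain $\Omega\subset\mathbb{C}^n$ is a $\delta$-John domain, $\delta>0$, if there is a point $x_0\in\Omega$ which can be joined with any point $x\in\Omega$ by a continuous curve $\gamma\subset\Omega$ satisfying $\delta|\xi-x|\leq d_\Omega(\xi)$ for all $\xi\in\gamma$, where $d_\Omega(\xi)$ is the Euclidean distance from $\xi$ to the boundary of $\Omega$. (A $\delta$-John domain is bounded.) Weights: for $\omega\in L^1_{loc}(\mathbb{R}^{m})$ with $\omega>0$ a.e., $p\in(0,\infty)$ and a measurable set $E\subset\mathbb{R}^m$, $$\|f\|_{p,E,\omega}=\left(\int_E|f(x)|^p\omega(x)\,d\mu(x)\right)^{1/p},$$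 $L^p(E,\omega)$ is the space of measurable functions $f$ with $\|f\|_{p,E,\omega}<\infty$, and, if $0<\int_E\omega\,d\mu<\infty$, the average is $$f_{E,\omega}=\frac{\int_E f(x)\omega(x)\,d\mu(x)}{\int_E\omega(x)\,d\mu(x)}.$$ For $q\in(1,\infty)$ and $M\in[1,\infty)$, $\omega\in A^q_M(\mathbb{C}^n)$ (Muckenhoupt weight) means $\omega\in L^1_{loc}$, $\omega>0$ a.e., and for each cube or ball $Q\subset\mathbb{C}^n\cong\mathbb{R}^{2n}$, $$\int_Q\omega\,d\mu\leq M|Q|^{q}\left(\int_Q\omega^{1/(1-q)}\,d\mu\right)^{1-q}.$$ *)

theory Defs
  imports "HOL-Analysis.Analysis"
begin

text \<open>
  \<open>\<complex>\<^sup>n\<close> is the type \<open>complex ^ 'n\<close>. As a Euclidean space it has dimension \<open>2 * CARD('n)\<close>, with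
  basis vectors \<open>axis j 1\<close> and \<open>axis j \<i>\<close>, so its norm and \<open>lebesgue\<close> are those of \<open>\<real>\<^sup>2\<^sup>n\<close>.
\<close>

definition holomorphic_Cn_on :: "(complex ^ 'n \<Rightarrow> complex) \<Rightarrow> (complex ^ 'n) set \<Rightarrow> bool" where
  "holomorphic_Cn_on f S \<longleftrightarrow>
     (\<forall>z\<in>S. \<exists>f'. (f has_derivative f') (at z) \<and> (\<forall>c v. f' (c *s v) = c * f' v))"

definition C2_on :: "('a::real_normed_vector \<Rightarrow> 'b::real_normed_vector) \<Rightarrow> 'a set \<Rightarrow> bool" where
  "C2_on f S \<longleftrightarrow>
     (\<exists>(f' :: 'a \<Rightarrow> 'a \<Rightarrow>\<^sub>L 'b) (f'' :: 'a \<Rightarrow> 'a \<Rightarrow>\<^sub>L 'a \<Rightarrow>\<^sub>L 'b).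
        (\<forall>x\<in>S. (f has_derivative blinfun_apply (f' x)) (at x)) \<and>
        (\<forall>x\<in>S. (f' has_derivative blinfun_apply (f'' x)) (at x)) \<and>
        continuous_on S f'')"

text \<open>
  The Wirtinger derivatives \<open>(\<partial>\<^sub>x - \<i> \<partial>\<^sub>y) / 2\<close> and \<open>(\<partial>\<^sub>x + \<i> \<partial>\<^sub>y) / 2\<close> in the coordinate
  \<open>z $ j = x + \<i> y\<close>; meaningful at points of real differentiability.
\<close>

definition wirtinger :: "'n \<Rightarrow> (complex ^ 'n \<Rightarrow> complex) \<Rightarrow> complex ^ 'n \<Rightarrow> complex" where
  "wirtinger j f z =
     (frechet_derivative f (at z) (axis j 1) - \<i> * frechet_derivative f (at z) (axis j \<i>)) / 2"

definition wirtinger_bar :: "'n \<Rightarrow> (complex ^ 'n \<Rightarrow> complex) \<Rightarrow> complex ^ 'n \<Rightarrow> complex" where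
  "wirtinger_bar j f z =
     (frechet_derivative f (at z) (axis j 1) + \<i> * frechet_derivative f (at z) (axis j \<i>)) / 2"

definition pluriharmonic_on :: "(complex ^ 'n \<Rightarrow> complex) \<Rightarrow> (complex ^ 'n) set \<Rightarrow> bool" where
  "pluriharmonic_on f S \<longleftrightarrow>
     C2_on f S \<and> (\<forall>z\<in>S. \<forall>j k. wirtinger j (wirtinger_bar k f) z = 0)"

definition john_domain :: "real \<Rightarrow> 'a::euclidean_space set \<Rightarrow> bool" where
  "john_domain \<delta> \<Omega> \<longleftrightarrow>
     open \<Omega> \<and> connected \<Omega> \<and> \<Omega> \<noteq> {} \<and> \<Omega> \<noteq> UNIV \<and>
     (\<exists>x0\<in>\<Omega>. \<forall>x\<in>\<Omega>. \<exists>\<gamma>. path \<gamma> \<and> path_image \<gamma> \<subseteq> \<Omega> \<and> pathstart \<gamma> = x0 \<and> pathfinish \<gamma> = x \<and>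
        (\<forall>\<xi>\<in>path_image \<gamma>. \<delta> * dist \<xi> x \<le> infdist \<xi> (frontier \<Omega>)))"

definition locally_integrable :: "('a::euclidean_space \<Rightarrow> real) \<Rightarrow> bool" where
  "locally_integrable \<omega> \<longleftrightarrow> (\<forall>K. compact K \<longrightarrow> set_integrable lebesgue K \<omega>)"

definition weight :: "('a::euclidean_space \<Rightarrow> real) \<Rightarrow> bool" where
  "weight \<omega> \<longleftrightarrow> locally_integrable \<omega> \<and> (AE x in lebesgue. 0 < \<omega> x)"

text \<open>Real-valued, hence only meaningful for functions satisfying \<open>in_Lp\<close> below.\<close>

definition Lp_norm :: "real \<Rightarrow> 'a::euclidean_space set \<Rightarrow> ('a \<Rightarrow> real) \<Rightarrow> ('a \<Rightarrow> complex) \<Rightarrow> real" where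
  "Lp_norm p E \<omega> f = (LINT x:E|lebesgue. norm (f x) powr p * \<omega> x) powr (1 / p)"

definition in_Lp :: "real \<Rightarrow> 'a::euclidean_space set \<Rightarrow> ('a \<Rightarrow> real) \<Rightarrow> ('a \<Rightarrow> complex) \<Rightarrow> bool" where
  "in_Lp p E \<omega> f \<longleftrightarrow> set_borel_measurable lebesgue E f \<and>
     set_integrable lebesgue E (\<lambda>x. norm (f x) powr p * \<omega> x)"

definition weighted_average ::
    "'a::euclidean_space set \<Rightarrow> ('a \<Rightarrow> real) \<Rightarrow> ('a \<Rightarrow> complex) \<Rightarrow> complex" where
  "weighted_average E \<omega> f =
     (LINT x:E|lebesgue. f x * of_real (\<omega> x)) / of_real (LINT x:E|lebesgue. \<omega> x)"

definition is_cube :: "'a::euclidean_space set \<Rightarrow> bool" where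
  "is_cube Q \<longleftrightarrow> (\<exists>a l. 0 < l \<and> Q = cbox a (a + l *\<^sub>R One))"

definition is_ball :: "'a::metric_space set \<Rightarrow> bool" where
  "is_ball Q \<longleftrightarrow> (\<exists>a r. 0 < r \<and> Q = cball a r)"

text \<open>
  Closed cubes with sides parallel to the axes and closed balls are used; the boundary is a null set,
  so open ones give the same condition. If the integral of \<open>\<omega> powr (1 / (1 - q))\<close> over \<open>Q\<close> were
  infinite, the right-hand side of the inequality would be zero (as \<open>1 - q < 0\<close>) and the left-hand
  side positive; hence integrability is part of the condition.
\<close>

definition muckenhoupt :: "real \<Rightarrow> real \<Rightarrow> ('a::euclidean_space \<Rightarrow> real) \<Rightarrow> bool" where
  "muckenhoupt q M \<omega> \<longleftrightarrow> weight \<omega> \<and>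
     (\<forall>Q. is_cube Q \<or> is_ball Q \<longrightarrow>
        set_integrable lebesgue Q (\<lambda>x. \<omega> x powr (1 / (1 - q))) \<and>
        (LINT x:Q|lebesgue. \<omega> x)
          \<le> M * measure lebesgue Q powr q *
              (LINT x:Q|lebesgue. \<omega> x powr (1 / (1 - q))) powr (1 - q))"

end

theory Submission
  imports Defs "HOL-Complex_Analysis.Conformal_Mappings"
begin

text \<open>
  Let \<open>f = h + cnj g\<close> and let \<open>\<nu>\<close> be the measure \<open>\<omega> d\<mu>\<close>. Locally, \<open>h\<close> is controlled by \<open>f\<close> up to a constant:
  on complex lines the Borel-Caratheodory inequality bounds the oscillation of \<open>h\<close> on a small ball by the
  supremum of the norm of \<open>f\<close> on a larger one (\<open>holomorphic_part_oscillation\<close>). The weight enters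
  only through the fact that \<open>\<nu>\<close> is doubling (\<open>muckenhoupt_doubling\<close>), so \<open>p\<close> and \<open>q\<close> are unrelated. For a
  doubling measure, the oscillation estimate implies that the supremum of \<open>norm f powr p\<close> on a ball
  is at most a constant times its \<open>\<nu>\<close>-average over the ball of twice the radius (\<open>norm_powr_le_average\<close>).

  Globally, the oscillations must be summed along the John curves. In \<open>L\<^sup>1\<close> this is easy: a curve from \<open>x0\<close> to
  \<open>x\<close> is covered by balls of radius comparable to the distance to the boundary, and, by the John condition and
  the doubling property, the set of the points \<open>x\<close> for which a given ball is used has measure at most a
  constant times that of the ball (\<open>john_integral_le\<close>). For \<open>p > 1\<close> one would expect to need maximal functions or duality.
  They are avoided by applying the \<open>L\<^sup>1\<close> estimate to \<open>norm (h - h x0) powr p\<close>. Its oscillation on a ball is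
  bounded by a small multiple of its own average and a large multiple of the average of \<open>norm f powr p\<close>
  (\<open>abs_powr_diff_le\<close>). As \<open>h \<in> L\<^sup>p\<close> and \<open>\<Omega>\<close> is bounded, the former can be absorbed into the left-hand side
  (\<open>holomorphic_deviation_integral_le\<close>). Finally the constant \<open>h x0\<close> is replaced by the weighted average, and
  \<open>g\<close> is treated like \<open>h\<close>, because the conjugate of \<open>f\<close> is \<open>g + cnj h\<close>.
\<close>

section \<open>Oscillation of the holomorphic part of a pluriharmonic function\<close>

text \<open>
  The Borel-Caratheodory inequality, from the Schwarz lemma: \<open>w \<mapsto> w / (2 * A - w)\<close> maps the
  half-plane \<open>Re w < A\<close> into the unit disc and fixes \<open>0\<close>, and \<open>H\<close> is recovered from its image.
\<close>
lemma borel_caratheodory_disc: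
  fixes H :: "complex \<Rightarrow> complex"
  assumes hol: "H holomorphic_on ball 0 1" and H0: "H 0 = 0" and A: "0 < A"
    and Re: "\<And>z. norm z < 1 \<Longrightarrow> Re (H z) < A" and z: "norm z \<le> 1 / 2"
  shows "norm (H z) \<le> 4 * A * norm z"
proof -
  define \<phi> where "\<phi> = (\<lambda>z. H z / (of_real (2 * A) - H z))"
  have lt: "norm (H w) < norm (of_real (2 * A) - H w)" if "norm w < 1" for w
  proof -
    have "(2 * A - Re (H w))\<^sup>2 = (Re (H w))\<^sup>2 + 4 * A * (A - Re (H w))"
      by (simp add: power2_eq_square algebra_simps)
    moreover have "0 < 4 * A * (A - Re (H w))" using A Re[OF that] by simp
    ultimately show ?thesis by (simp add: cmod_def)
  qed
  have ne: "of_real (2 * A) - H w \<noteq> 0" if "norm w < 1" for w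
    using lt[OF that] by auto
  have "norm (\<phi> z) \<le> norm z"
  proof (rule Schwarz_Lemma(1))
    show "\<phi> holomorphic_on ball 0 1"
      unfolding \<phi>_def using ne by (intro holomorphic_intros hol) auto
    show "\<phi> 0 = 0" by (simp add: \<phi>_def H0)
    show "norm (\<phi> w) < 1" if "norm w < 1" for w
      using lt[OF that] ne[OF that] by (simp add: \<phi>_def norm_divide divide_simps)
    show "norm z < 1" using z by simp
  qed
  then have "norm (H z) \<le> norm z * norm (of_real (2 * A) - H z)"
    using lt[of z] z by (simp add: \<phi>_def norm_divide divide_simps split: if_splits)
  also have "\<dots> \<le> norm z * (2 * A + norm (H z))"
    using norm_triangle_ineq4[of "of_real (2 * A)" "H z"] A by (intro mult_left_mono) auto
  also have "\<dots> \<le> 2 * A * norm z + 1 / 2 * norm (H z)"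
    using mult_right_mono[OF z, of "norm (H z)"] by (simp add: algebra_simps)
  finally show ?thesis by simp
qed

text \<open>
  The real part of \<open>F + cnj G\<close> is that of \<open>F + G\<close>, and its imaginary part is that of \<open>F - G\<close>. So a bound
  on \<open>F + cnj G\<close> controls one real component of each of two holomorphic functions, hence both functions
  up to constants, hence \<open>F\<close>, which is half their sum.
\<close>
lemma holomorphic_part_oscillation_disc:
  fixes F G :: "complex \<Rightarrow> complex"
  assumes F: "F holomorphic_on ball 0 1" and G: "G holomorphic_on ball 0 1"
    and m: "\<And>z. norm z < 1 \<Longrightarrow> norm (F z + cnj (G z)) \<le> m" and z: "norm z \<le> 1 / 2"
  shows "norm (F z - F 0) \<le> 12 * m * norm z"
proof -
  have bound: "norm (F z - F 0) \<le> 4 * A * norm z" if A: "2 * m < A" for A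
  proof -
    have m0: "0 \<le> m" using order_trans[OF norm_ge_zero m[of 0]] by simp
    define H1 where "H1 = (\<lambda>z. (F z + G z) - (F 0 + G 0))"
    \<comment> \<open>\<open>H2\<close> carries the factor \<open>- \<i>\<close> to turn a bound on an imaginary part into one on a real part.\<close>
    define H2 where "H2 = (\<lambda>z. - \<i> * ((F z - G z) - (F 0 - G 0)))"
    have re: "\<bar>Re (F w + G w)\<bar> \<le> m" and im: "\<bar>Im (F w - G w)\<bar> \<le> m" if "norm w < 1" for w
      using m[OF that] abs_Re_le_cmod[of "F w + cnj (G w)"] abs_Im_le_cmod[of "F w + cnj (G w)"]
      by auto
    have "norm (H1 z) \<le> 4 * A * norm z"
    proof (rule borel_caratheodory_disc)
      show "H1 holomorphic_on ball 0 1" unfolding H1_def by (intro holomorphic_intros F G)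
      show "Re (H1 w) < A" if "norm w < 1" for w
        using re[OF that] re[of 0] A by (simp add: H1_def)
    qed (use A m0 z in \<open>auto simp: H1_def\<close>)
    moreover have "norm (H2 z) \<le> 4 * A * norm z"
    proof (rule borel_caratheodory_disc)
      show "H2 holomorphic_on ball 0 1" unfolding H2_def by (intro holomorphic_intros F G)
      show "Re (H2 w) < A" if "norm w < 1" for w
        using im[OF that] im[of 0] A by (simp add: H2_def)
    qed (use A m0 z in \<open>auto simp: H2_def\<close>)
    moreover have "F z - F 0 = (H1 z + \<i> * H2 z) / 2"
      by (simp add: H1_def H2_def algebra_simps)
    then have "norm (F z - F 0) \<le> (norm (H1 z) + norm (H2 z)) / 2"
      using norm_triangle_ineq[of "H1 z" "\<i> * H2 z"]
      by (simp only: norm_mult norm_divide) simp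
    ultimately show ?thesis by simp
  qed
  \<comment> \<open>The strict inequality in the bound leaves \<open>m = 0\<close> to a limit.\<close>
  show ?thesis
  proof (cases "m = 0")
    case True
    have "norm (F z - F 0) \<le> 0 + e" if "0 < e" for e
    proof -
      have "4 * (e / 4) * norm z \<le> e" using that z by simp
      then show ?thesis using bound[of "e / 4"] that True by linarith
    qed
    then have "norm (F z - F 0) \<le> 0" by (rule field_le_epsilon)
    then show ?thesis using True by simp
  next
    case False
    then have "0 < m" using order_trans[OF norm_ge_zero m[of 0]] by simp
    then show ?thesis using bound[of "3 * m"] by simp
  qed
qed

lemma of_real_vector_scalar: "of_real c *s (v :: complex ^ 'n) = c *\<^sub>R v"
  by (simp add: vec_eq_iff scaleR_conv_of_real[where 'a = complex])

lemma norm_vector_scalar: "norm (c *s (v :: complex ^ 'n)) = norm c * norm v"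
  by (simp add: norm_vec_def norm_mult L2_set_right_distrib)

lemma bounded_linear_vector_scalar: "bounded_linear (\<lambda>c. c *s (v :: complex ^ 'n))"
  by (intro bounded_linear_intro[where K = "norm v"])
     (auto simp: vec_eq_iff algebra_simps scaleR_conv_of_real[where 'a = complex] norm_vector_scalar)

lemma holomorphic_Cn_on_slice:
  assumes h: "holomorphic_Cn_on h S" and sub: "\<And>c. c \<in> D \<Longrightarrow> z + c *s v \<in> S" and D: "open D"
  shows "(\<lambda>c. h (z + c *s v)) holomorphic_on D"
  unfolding holomorphic_on_open[OF D]
proof
  fix c assume c: "c \<in> D"
  then obtain h' where h': "(h has_derivative h') (at (z + c *s v))" "\<And>c v. h' (c *s v) = c * h' v"
    using h sub unfolding holomorphic_Cn_on_def by blast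
  have "((\<lambda>c. z + c *s v) has_derivative (\<lambda>c. c *s v)) (at c)"
    using has_derivative_add[OF has_derivative_const
        bounded_linear_imp_has_derivative[OF bounded_linear_vector_scalar]] by simp
  from has_derivative_compose[OF this h'(1)] h'(2)
  have "((\<lambda>c. h (z + c *s v)) has_derivative (\<lambda>c. h' v * c)) (at c)"
    by (simp add: mult.commute)
  then show "\<exists>f'. ((\<lambda>c. h (z + c *s v)) has_field_derivative f') (at c)"
    unfolding has_field_derivative_def by (intro exI[of _ "h' v"]) (simp add: mult_commute_abs)
qed

text \<open>
  This is the one place where pluriharmonicity, as opposed to the mere size of the functions, enters: the
  bound is the one on the disc, applied on the complex line through \<open>z\<close> and \<open>w\<close>. Taking small \<open>t\<close>
  replaces a gradient estimate.
\<close>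
lemma holomorphic_part_oscillation:
  fixes h g :: "complex ^ 'n \<Rightarrow> complex"
  assumes h: "holomorphic_Cn_on h S" and g: "holomorphic_Cn_on g S" and sub: "cball z \<rho> \<subseteq> S"
    and m: "\<And>w. w \<in> cball z \<rho> \<Longrightarrow> norm (h w + cnj (g w)) \<le> m"
    and w: "dist z w \<le> t * \<rho>" and t: "t \<le> 1 / 2" and \<rho>: "0 < \<rho>"
  shows "norm (h w - h z) \<le> 12 * t * m"
proof (cases "w = z")
  case True
  have "0 \<le> t" using w \<rho> zero_le_dist[of z w] True by (simp add: zero_le_mult_iff)
  moreover have "0 \<le> m" using order_trans[OF norm_ge_zero m[of z]] \<rho> by simp
  ultimately show ?thesis using True by simp
next
  case False
  \<comment> \<open>The line is parametrised so that the unit disc has radius \<open>\<rho>\<close> in it; \<open>w\<close> then has the parameter \<open>c\<close>.\<close>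
  define r where "r = dist z w"
  define v where "v = (\<rho> / r) *\<^sub>R (w - z)"
  define c where "c = complex_of_real (r / \<rho>)"
  have r: "0 < r" using False by (simp add: r_def)
  have nv: "norm v = \<rho>" using r \<rho> by (simp add: v_def r_def dist_norm norm_minus_commute)
  have w_eq: "z + c *s v = w"
    using r \<rho> by (simp only: c_def of_real_vector_scalar) (simp add: v_def)
  have in_ball: "z + a *s v \<in> cball z \<rho>" if "norm a < 1" for a
    using that \<rho> by (simp add: dist_norm norm_vector_scalar nv mult_le_cancel_right1)
  have nc: "norm c \<le> t"
    using w r \<rho> by (simp add: c_def r_def norm_divide pos_divide_le_eq)
  have "norm (h (z + c *s v) - h (z + 0 *s v)) \<le> 12 * m * norm c"
  proof (rule holomorphic_part_oscillation_disc)
    show "(\<lambda>c. h (z + c *s v)) holomorphic_on ball 0 1" "(\<lambda>c. g (z + c *s v)) holomorphic_on ball 0 1"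
      using in_ball sub by (auto intro!: holomorphic_Cn_on_slice[OF h] holomorphic_Cn_on_slice[OF g])
  qed (use in_ball m nc t in auto)
  also have "\<dots> \<le> 12 * m * t"
    using m[of z] \<rho> nc order_trans[OF norm_ge_zero m[of z]] by (intro mult_left_mono) auto
  finally show ?thesis by (simp add: w_eq algebra_simps)
qed

section \<open>A sub-mean value inequality for doubling measures\<close>

text \<open>
  The doubling condition is stated for balls with different centres and with an explicit power of the ratio
  of the radii, because this is how the Muckenhoupt condition yields it. Working on the Borel sets keeps
  products of the measure with itself well behaved.
\<close>
locale doubling_measure =
  fixes \<nu> :: "'a::euclidean_space measure" and A \<kappa> :: real
  assumes sets_borel [measurable_cong]: "sets \<nu> = sets borel"
    and finite_cball: "emeasure \<nu> (cball x r) < \<infinity>"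
    and cball_pos: "0 < r \<Longrightarrow> 0 < measure \<nu> (cball x r)"
    and doubling: "0 < r \<Longrightarrow> cball y r \<subseteq> cball x R \<Longrightarrow>
          measure \<nu> (cball x R) \<le> A * (R / r) powr \<kappa> * measure \<nu> (cball y r)"
    and exponent_pos: "0 < \<kappa>"
begin

lemma constant_ge_1: "1 \<le> A"
  using doubling[of 1 0 0 1] cball_pos[of 1 0] by simp

lemma sigma_finite: "sigma_finite_measure \<nu>"
proof
  show "\<exists>F. countable F \<and> F \<subseteq> sets \<nu> \<and> \<Union> F = space \<nu> \<and> (\<forall>a\<in>F. emeasure \<nu> a \<noteq> \<infinity>)"
  proof (intro exI[of _ "range (\<lambda>n::nat. cball 0 (real n))"] conjI ballI)
    have "x \<in> (\<Union>n::nat. cball 0 (real n))" for x :: 'a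
      using real_arch_simple[of "norm x"] by auto
    then show "\<Union> (range (\<lambda>n::nat. cball 0 (real n))) = space \<nu>"
      using sets_eq_imp_space_eq[OF sets_borel] by auto
  qed (use finite_cball in \<open>auto simp: sets_borel less_top\<close>)
qed

lemma emeasure_cball: "emeasure \<nu> (cball x r) = ennreal (measure \<nu> (cball x r))"
  using finite_cball[of x r] by (simp add: emeasure_eq_ennreal_measure less_top)

text \<open>
  A sub-mean value inequality for an arbitrary positive exponent and an arbitrary doubling measure. Such an
  inequality is usually derived from the mean value property; here it follows from the oscillation estimate
  alone. Weighting \<open>norm (F z)\<close> by the power \<open>\<kappa> / p\<close> of the distance of \<open>z\<close> to the sphere, and maximising
  over the closed ball, gives a point \<open>z0\<close> near which \<open>F\<close> is at most a fixed multiple of \<open>F z0\<close>. By the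
  oscillation estimate \<open>F\<close> is then comparable to \<open>F z0\<close> on a smaller ball about \<open>z0\<close>. The power is chosen
  so that the loss in the measure of that ball is exactly compensated by the weight.
\<close>
lemma norm_powr_le_average:
  fixes F :: "'a \<Rightarrow> 'b::real_normed_vector"
  assumes cont: "continuous_on (cball \<xi> R) F" and R: "0 < R" and p: "0 < p" and L: "1 \<le> L"
    and osc: "\<And>z \<rho> m w t. \<lbrakk>cball z \<rho> \<subseteq> cball \<xi> R; 0 < \<rho>; \<And>u. u \<in> cball z \<rho> \<Longrightarrow> norm (F u) \<le> m;
                 t \<le> 1 / 2; dist z w \<le> t * \<rho>\<rbrakk> \<Longrightarrow> norm (F w - F z) \<le> L * t * m"
    and w: "dist \<xi> w \<le> R / 2"
  defines "B \<equiv> 2 powr p * A * (8 * L * 2 powr (\<kappa> / p)) powr \<kappa>"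
  shows "ennreal (norm (F w) powr p * measure \<nu> (cball \<xi> R))
           \<le> ennreal B * (\<integral>\<^sup>+u\<in>cball \<xi> R. ennreal (norm (F u) powr p) \<partial>\<nu>)"
proof -
  define \<alpha> where "\<alpha> = \<kappa> / p"
  have \<alpha>: "0 < \<alpha>" "\<alpha> * p = \<kappa>" using p exponent_pos by (auto simp: \<alpha>_def)
  define \<phi> where "\<phi> = (\<lambda>z. (R - dist \<xi> z) powr \<alpha> * norm (F z))"
  have "continuous_on (cball \<xi> R) \<phi>"
    unfolding \<phi>_def using \<alpha> cont by (intro continuous_intros continuous_on_powr') auto
  then obtain z0 where z0: "z0 \<in> cball \<xi> R" and max: "\<And>z. z \<in> cball \<xi> R \<Longrightarrow> \<phi> z \<le> \<phi> z0"
    using continuous_attains_sup[of "cball \<xi> R" \<phi>] R by auto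
  define \<rho> where "\<rho> = (R - dist \<xi> z0) / 2"
  have two_\<rho>: "2 * \<rho> = R - dist \<xi> z0" by (simp add: \<rho>_def)
  have w_max: "(R / 2) powr \<alpha> * norm (F w) \<le> (2 * \<rho>) powr \<alpha> * norm (F z0)"
  proof -
    have "(R / 2) powr \<alpha> * norm (F w) \<le> (R - dist \<xi> w) powr \<alpha> * norm (F w)"
      using w R \<alpha> by (intro mult_right_mono powr_mono2) auto
    also have "\<dots> \<le> (2 * \<rho>) powr \<alpha> * norm (F z0)"
      using max[of w] w R by (simp add: \<phi>_def two_\<rho>)
    finally show ?thesis .
  qed
  show ?thesis
  proof (cases "\<rho> = 0 \<or> F z0 = 0")
    case True
    then have "(R / 2) powr \<alpha> * norm (F w) \<le> 0" using w_max by auto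
    then have "F w = 0" using R by (simp add: mult_le_0_iff)
    then show ?thesis using p by simp
  next
    case False
    then have \<rho>: "0 < \<rho>" "2 * \<rho> \<le> R" using z0 by (auto simp: \<rho>_def)
    \<comment> \<open>On the ball of radius \<open>t * \<rho>\<close> the oscillation is at most half of \<open>norm (F z0)\<close>.\<close>
    define t where "t = 1 / (2 * L * 2 powr \<alpha>)"
    have "1 * 1 \<le> L * 2 powr \<alpha>"
      using L \<alpha> by (intro mult_mono ge_one_powr_ge_zero) auto
    then have t: "0 < t" "t \<le> 1 / 2" "L * t * 2 powr \<alpha> = 1 / 2"
      using L by (auto simp: t_def field_simps)
    have ball_sub: "cball z0 \<rho> \<subseteq> cball \<xi> R"
    proof
      fix u assume "u \<in> cball z0 \<rho>"
      then show "u \<in> cball \<xi> R" using dist_triangle[of \<xi> u z0] \<rho> by (simp add: \<rho>_def)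
    qed
    have near: "norm (F u) \<le> 2 powr \<alpha> * norm (F z0)" if u: "u \<in> cball z0 \<rho>" for u
    proof -
      have "\<rho> \<le> R - dist \<xi> u" using u dist_triangle[of \<xi> u z0] by (simp add: \<rho>_def field_simps)
      then have "\<rho> powr \<alpha> * norm (F u) \<le> \<phi> u"
        unfolding \<phi>_def using \<rho> \<alpha> by (intro mult_right_mono powr_mono2) auto
      also have "\<dots> \<le> (2 * \<rho>) powr \<alpha> * norm (F z0)"
        using max[of u] u ball_sub by (auto simp: \<phi>_def two_\<rho>)
      also have "\<dots> = \<rho> powr \<alpha> * (2 powr \<alpha> * norm (F z0))" using \<rho> by (simp add: powr_mult)
      finally show ?thesis using \<rho> by simp
    qed
    have half: "norm (F z0) / 2 \<le> norm (F u)" if u: "u \<in> cball z0 (t * \<rho>)" for u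
    proof -
      have "norm (F u - F z0) \<le> L * t * (2 powr \<alpha> * norm (F z0))"
        using osc[OF ball_sub \<rho>(1) near t(2)] u by simp
      also have "\<dots> = norm (F z0) / 2" using t(3) by (metis mult.assoc mult.commute times_divide_eq_right mult_1_right)
      finally show ?thesis using norm_triangle_ineq2[of "F z0" "F u"] by (simp add: norm_minus_commute)
    qed
    define J where "J = (\<integral>\<^sup>+u\<in>cball \<xi> R. ennreal (norm (F u) powr p) \<partial>\<nu>)"
    let ?b = "cball z0 (t * \<rho>)"
    have "t * \<rho> \<le> \<rho>" using t \<rho> mult_right_mono[of t 1 \<rho>] by simp
    then have b_sub: "?b \<subseteq> cball \<xi> R" using order_trans[OF subset_cball ball_sub] by blast
    have "ennreal ((norm (F z0) / 2) powr p * measure \<nu> ?b)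
            = (\<integral>\<^sup>+u. ennreal ((norm (F z0) / 2) powr p) * indicator ?b u \<partial>\<nu>)"
      by (subst nn_integral_cmult_indicator) (auto simp: emeasure_cball ennreal_mult sets_borel)
    also have "\<dots> \<le> J"
      unfolding J_def
    proof (intro nn_integral_mono)
      fix u
      show "ennreal ((norm (F z0) / 2) powr p) * indicator ?b u
              \<le> ennreal (norm (F u) powr p) * indicator (cball \<xi> R) u"
        using half[of u] b_sub p by (auto simp: indicator_def intro!: ennreal_leI powr_mono2)
    qed
    finally have J: "ennreal ((norm (F z0) / 2) powr p * measure \<nu> ?b) \<le> J" .
    have dbl: "measure \<nu> (cball \<xi> R) \<le> A * (R / (t * \<rho>)) powr \<kappa> * measure \<nu> ?b"
      using doubling[OF _ b_sub] t \<rho> by simp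
    have w_max': "(R / 2) powr \<kappa> * norm (F w) powr p \<le> (2 * \<rho>) powr \<kappa> * norm (F z0) powr p"
      using powr_mono2[OF less_imp_le[OF p] _ w_max] R \<rho> p by (simp add: powr_mult powr_powr \<alpha>)
    have "norm (F w) powr p * measure \<nu> (cball \<xi> R)
        \<le> norm (F w) powr p * (A * (R / (t * \<rho>)) powr \<kappa> * measure \<nu> ?b)"
      by (intro mult_left_mono dbl) auto
    also have "\<dots> = ((R / 2) powr \<kappa> * norm (F w) powr p) * (A * (2 / (t * \<rho>)) powr \<kappa> * measure \<nu> ?b)"
      using R t \<rho> by (simp add: powr_divide powr_mult)
    also have "\<dots> \<le> ((2 * \<rho>) powr \<kappa> * norm (F z0) powr p) * (A * (2 / (t * \<rho>)) powr \<kappa> * measure \<nu> ?b)"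
      using constant_ge_1 by (intro mult_right_mono w_max') auto
    also have "\<dots> = B * ((norm (F z0) / 2) powr p * measure \<nu> ?b)"
    proof -
      have "(2 * \<rho>) powr \<kappa> * (2 / (t * \<rho>)) powr \<kappa> = (4 / t) powr \<kappa>"
        using t \<rho> by (simp flip: powr_mult)
      also have "4 / t = 8 * L * 2 powr (\<kappa> / p)" by (simp add: t_def \<alpha>_def)
      finally have eq: "(2 * \<rho>) powr \<kappa> * (2 / (t * \<rho>)) powr \<kappa> = (8 * L * 2 powr (\<kappa> / p)) powr \<kappa>" .
      have "(norm (F z0) / 2) powr p = norm (F z0) powr p / 2 powr p" by (rule powr_divide)
      then show ?thesis by (simp add: B_def flip: eq)
    qed
    finally have "ennreal (norm (F w) powr p * measure \<nu> (cball \<xi> R))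
        \<le> ennreal (B * ((norm (F z0) / 2) powr p * measure \<nu> ?b))" by (rule ennreal_leI)
    also have "\<dots> = ennreal B * ennreal ((norm (F z0) / 2) powr p * measure \<nu> ?b)"
      using constant_ge_1 by (intro ennreal_mult) (auto simp: B_def)
    also have "\<dots> \<le> ennreal B * J" using J by (intro mult_left_mono) auto
    finally show ?thesis by (simp add: J_def)
  qed
qed

end

section \<open>The Poincare inequality on John domains\<close>

lemma infdist_frontier_pos:
  assumes "open \<Omega>" "\<Omega> \<noteq> UNIV" "x \<in> \<Omega>"
  shows "0 < infdist x (frontier (\<Omega> :: 'a::euclidean_space set))"
proof (rule infdist_pos_not_in_closed)
  show "frontier \<Omega> \<noteq> {}" using assms frontier_not_empty[of \<Omega>] by auto
  show "x \<notin> frontier \<Omega>" using assms frontier_disjoint_eq[of \<Omega>] by auto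
qed simp

lemma cball_subset_of_infdist_frontier:
  assumes "x \<in> \<Omega>" "r < infdist x (frontier (\<Omega> :: 'a::euclidean_space set))"
  shows "cball x r \<subseteq> \<Omega>"
proof (cases "0 \<le> r")
  case True
  have "cball x r \<inter> frontier \<Omega> = {}"
    using infdist_le[of _ "frontier \<Omega>" x] assms(2) by fastforce
  moreover have "x \<in> cball x r \<inter> \<Omega>" using True assms(1) by simp
  ultimately show ?thesis
    using connected_Int_frontier[of "cball x r" \<Omega>] convex_connected[OF convex_cball[of x r]] by blast
qed auto

context doubling_measure
begin

text \<open>
  In the applications \<open>d\<close> is the distance to the boundary. Then \<open>D = 1\<close> averages over a Whitney ball, and a
  larger \<open>D\<close> makes \<open>kernel d D x y\<close> nonzero for the points \<open>y\<close> that may lie on a John curve ending at \<open>x\<close>.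
\<close>
definition kernel :: "('a \<Rightarrow> real) \<Rightarrow> real \<Rightarrow> 'a \<Rightarrow> 'a \<Rightarrow> ennreal" where
  "kernel d D x y = (if dist x y \<le> D * d y then ennreal (1 / measure \<nu> (cball y (d y))) else 0)"

lemma measurable_kernel [measurable]:
  assumes [measurable]: "d \<in> borel_measurable borel" "f \<in> measurable N borel" "g \<in> measurable N borel"
  shows "(\<lambda>z. kernel d D (f z) (g z)) \<in> borel_measurable N"
proof -
  interpret sigma_finite_measure \<nu> by (rule sigma_finite)
  have [measurable]: "(\<lambda>y. measure \<nu> (cball y (d y))) \<in> borel_measurable borel"
  proof (rule measurable_measure)
    have "Measurable.pred (borel \<Otimes>\<^sub>M \<nu>) (\<lambda>z. dist (fst z) (snd z) \<le> d (fst z))" by measurable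
    then show "{x \<in> space (borel \<Otimes>\<^sub>M \<nu>). snd x \<in> cball (fst x) (d (fst x))} \<in> sets (borel \<Otimes>\<^sub>M \<nu>)"
      by (simp add: pred_def)
  qed (auto simp: sets_eq_imp_space_eq[OF sets_borel])
  show ?thesis unfolding kernel_def by measurable
qed

text \<open>
  After exchanging the integrals, integrating out \<open>x\<close> gives the ratio of the measures of two concentric
  balls about \<open>y\<close>, and this is bounded by the doubling condition.
\<close>
lemma kernel_integral_le:
  assumes d [measurable]: "d \<in> borel_measurable borel" and \<Omega> [measurable]: "\<Omega> \<in> sets borel"
    and pos: "\<And>y. y \<in> \<Omega> \<Longrightarrow> 0 < d y" and D: "1 \<le> D" and G [measurable]: "G \<in> borel_measurable borel"
  shows "(\<integral>\<^sup>+x\<in>\<Omega>. (\<integral>\<^sup>+y\<in>\<Omega>. kernel d D x y * G y \<partial>\<nu>) \<partial>\<nu>)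
           \<le> ennreal (A * D powr \<kappa>) * (\<integral>\<^sup>+y\<in>\<Omega>. G y \<partial>\<nu>)"
proof -
  interpret sigma_finite_measure \<nu> by (rule sigma_finite)
  interpret pair_sigma_finite \<nu> \<nu> ..
  have "(\<integral>\<^sup>+x\<in>\<Omega>. (\<integral>\<^sup>+y\<in>\<Omega>. kernel d D x y * G y \<partial>\<nu>) \<partial>\<nu>)
          \<le> (\<integral>\<^sup>+x. (\<integral>\<^sup>+y\<in>\<Omega>. kernel d D x y * G y \<partial>\<nu>) \<partial>\<nu>)"
    by (intro nn_integral_mono) (auto simp: indicator_def)
  also have "\<dots> = (\<integral>\<^sup>+y. (\<integral>\<^sup>+x. kernel d D x y * (G y * indicator \<Omega> y) \<partial>\<nu>) \<partial>\<nu>)"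
    unfolding mult.assoc by (rule Fubini'[symmetric]) measurable
  also have "\<dots> = (\<integral>\<^sup>+y. (\<integral>\<^sup>+x. kernel d D x y \<partial>\<nu>) * (G y * indicator \<Omega> y) \<partial>\<nu>)"
    by (intro nn_integral_cong nn_integral_multc) measurable
  also have "\<dots> \<le> (\<integral>\<^sup>+y. ennreal (A * D powr \<kappa>) * (G y * indicator \<Omega> y) \<partial>\<nu>)"
  proof (intro nn_integral_mono)
    fix y
    show "(\<integral>\<^sup>+x. kernel d D x y \<partial>\<nu>) * (G y * indicator \<Omega> y) \<le> ennreal (A * D powr \<kappa>) * (G y * indicator \<Omega> y)"
    proof (cases "y \<in> \<Omega>")
      case True
      let ?r = "d y"
      have r: "0 < ?r" using pos[OF True] .
      have "(\<integral>\<^sup>+x. kernel d D x y \<partial>\<nu>)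
          = (\<integral>\<^sup>+x. ennreal (1 / measure \<nu> (cball y ?r)) * indicator (cball y (D * ?r)) x \<partial>\<nu>)"
        by (intro nn_integral_cong) (auto simp: kernel_def indicator_def dist_commute)
      also have "\<dots> = ennreal (1 / measure \<nu> (cball y ?r)) * ennreal (measure \<nu> (cball y (D * ?r)))"
        by (subst nn_integral_cmult_indicator) (auto simp: emeasure_cball sets_borel)
      also have "\<dots> = ennreal (measure \<nu> (cball y (D * ?r)) / measure \<nu> (cball y ?r))"
        by (simp flip: ennreal_mult)
      also have "\<dots> \<le> ennreal (A * D powr \<kappa>)"
      proof (rule ennreal_leI)
        have "cball y ?r \<subseteq> cball y (D * ?r)" using r D by (intro subset_cball) simp
        from doubling[OF r this] show "measure \<nu> (cball y (D * ?r)) / measure \<nu> (cball y ?r) \<le> A * D powr \<kappa>"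
          using r cball_pos[OF r, of y] by (simp add: divide_simps)
      qed
      finally show ?thesis by (intro mult_right_mono) auto
    qed simp
  qed
  also have "\<dots> = ennreal (A * D powr \<kappa>) * (\<integral>\<^sup>+y\<in>\<Omega>. G y \<partial>\<nu>)"
    by (rule nn_integral_cmult) measurable
  finally show ?thesis .
qed

text \<open>
  Replaces the average over the Whitney ball of \<open>\<xi>\<close> by an expression in a nearby point \<open>y\<close>, so that it can
  be integrated over \<open>y\<close>. Balls about \<open>\<xi>\<close>, \<open>u\<close> and \<open>y\<close> of radii proportional to the distance to the
  boundary are comparable here.
\<close>
lemma average_le_kernel:
  assumes \<Omega>: "open \<Omega>" "\<Omega> \<noteq> UNIV" and \<xi>: "\<xi> \<in> \<Omega>"
  defines "d \<equiv> \<lambda>x. infdist x (frontier \<Omega>)"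
  assumes y: "dist \<xi> y \<le> d \<xi> / 80" and W [measurable]: "W \<in> borel_measurable borel"
  shows "ennreal (1 / measure \<nu> (cball \<xi> (d \<xi> / 4))) * (\<integral>\<^sup>+u\<in>cball \<xi> (d \<xi> / 4). W u \<partial>\<nu>)
           \<le> ennreal (A * 5 powr \<kappa>) * (\<integral>\<^sup>+u\<in>\<Omega>. kernel d 1 y u * W u \<partial>\<nu>)"
proof -
  have [measurable]: "d \<in> borel_measurable borel" "\<Omega> \<in> sets borel"
    unfolding d_def using \<Omega> by (auto intro!: borel_measurable_continuous_onI continuous_intros)
  have d\<xi>: "0 < d \<xi>" unfolding d_def by (rule infdist_frontier_pos[OF \<Omega> \<xi>])
  let ?B = "cball \<xi> (d \<xi> / 4)"
  have sub: "?B \<subseteq> \<Omega>"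
    using d\<xi> \<xi> by (intro cball_subset_of_infdist_frontier) (auto simp: d_def)
  have pointwise: "ennreal (1 / measure \<nu> ?B) \<le> ennreal (A * 5 powr \<kappa>) * kernel d 1 y u" if u: "u \<in> ?B" for u
  proof -
    have "\<bar>d \<xi> - d u\<bar> \<le> d \<xi> / 4"
      using u infdist_triangle_abs[of \<xi> "frontier \<Omega>" u] by (simp add: d_def)
    then have du: "3 / 4 * d \<xi> \<le> d u" "d u \<le> 5 / 4 * d \<xi>" by linarith+
    have yu: "dist y u \<le> d u"
      using dist_triangle3[of y u \<xi>] u y du d\<xi> unfolding mem_cball by linarith
    have "?B \<subseteq> cball u (d u)"
    proof
      fix w assume "w \<in> ?B"
      then show "w \<in> cball u (d u)"
        using dist_triangle3[of u w \<xi>] u du d\<xi> unfolding mem_cball by linarith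
    qed
    then have "measure \<nu> (cball u (d u)) \<le> A * (d u / (d \<xi> / 4)) powr \<kappa> * measure \<nu> ?B"
      using d\<xi> by (intro doubling) auto
    also have "\<dots> \<le> A * 5 powr \<kappa> * measure \<nu> ?B"
      using constant_ge_1 du d\<xi> exponent_pos
      by (intro mult_right_mono mult_left_mono powr_mono2) (auto simp: divide_simps)
    finally have "1 / measure \<nu> ?B \<le> A * 5 powr \<kappa> * (1 / measure \<nu> (cball u (d u)))"
      using cball_pos[of "d \<xi> / 4" \<xi>] cball_pos[of "d u" u] d\<xi> du
      by (simp add: divide_simps mult.commute)
    then have "ennreal (1 / measure \<nu> ?B) \<le> ennreal (A * 5 powr \<kappa> * (1 / measure \<nu> (cball u (d u))))"
      by (rule ennreal_leI)
    also have "\<dots> = ennreal (A * 5 powr \<kappa>) * kernel d 1 y u"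
      using yu constant_ge_1 by (subst ennreal_mult) (auto simp: kernel_def)
    finally show ?thesis .
  qed
  have [measurable]: "?B \<in> sets borel" by simp
  have "ennreal (1 / measure \<nu> ?B) * (\<integral>\<^sup>+u\<in>?B. W u \<partial>\<nu>)
      = (\<integral>\<^sup>+u. ennreal (1 / measure \<nu> ?B) * (W u * indicator ?B u) \<partial>\<nu>)"
    by (rule nn_integral_cmult[symmetric]) measurable
  also have "\<dots> \<le> (\<integral>\<^sup>+u. ennreal (A * 5 powr \<kappa>) * (kernel d 1 y u * W u * indicator \<Omega> u) \<partial>\<nu>)"
  proof (intro nn_integral_mono)
    fix u
    show "ennreal (1 / measure \<nu> ?B) * (W u * indicator ?B u)
        \<le> ennreal (A * 5 powr \<kappa>) * (kernel d 1 y u * W u * indicator \<Omega> u)"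
      using mult_right_mono[OF pointwise[of u], of "W u"] sub by (auto simp: indicator_def mult.assoc)
  qed
  also have "\<dots> = ennreal (A * 5 powr \<kappa>) * (\<integral>\<^sup>+u\<in>\<Omega>. kernel d 1 y u * W u \<partial>\<nu>)"
    by (rule nn_integral_cmult) measurable
  finally show ?thesis .
qed


text \<open>
  The curve need not be rectifiable, so nothing can be integrated along it. Instead, it is covered by finitely
  many Whitney balls whose concentric fifths are disjoint. The values of \<open>v\<close> along the curve fill the interval
  between \<open>v x0\<close> and \<open>v x\<close>, and this interval is covered by the images of the balls, so its length is at most
  twice the sum of the bounds \<open>a i\<close> for the oscillations. This avoids ordering the balls into a chain. Each \<open>a i\<close> is at
  most the average of \<open>G\<close> over the small ball, and since the small balls are disjoint these averages add up to
  one integral against the kernel; the John condition says that \<open>x\<close> is within its reach.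
\<close>
lemma path_oscillation_le_kernel:
  fixes v :: "'a \<Rightarrow> real"
  assumes \<Omega>: "open \<Omega>" "\<Omega> \<noteq> UNIV" and \<delta>: "0 < \<delta>"
  defines "d \<equiv> \<lambda>x. infdist x (frontier \<Omega>)"
  assumes \<gamma>: "path \<gamma>" "path_image \<gamma> \<subseteq> \<Omega>" "pathstart \<gamma> = x0" "pathfinish \<gamma> = x"
    and john: "\<And>\<xi>. \<xi> \<in> path_image \<gamma> \<Longrightarrow> \<delta> * dist \<xi> x \<le> d \<xi>"
    and v: "continuous_on \<Omega> v" and G [measurable]: "G \<in> borel_measurable borel"
    and osc: "\<And>\<xi> y z. \<lbrakk>\<xi> \<in> \<Omega>; dist \<xi> z \<le> d \<xi> / 16; dist \<xi> y < d \<xi> / 80\<rbrakk>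
                \<Longrightarrow> ennreal \<bar>v z - v \<xi>\<bar> \<le> G y"
  shows "ennreal \<bar>v x - v x0\<bar>
           \<le> 2 * (ennreal (A * 162 powr \<kappa>) * (\<integral>\<^sup>+y\<in>\<Omega>. kernel d (2 / \<delta> + 1) x y * G y \<partial>\<nu>))"
proof -
  let ?K = "path_image \<gamma>" and ?D = "2 / \<delta> + 1" and ?c = "ennreal (A * 162 powr \<kappa>)"
  let ?b = "\<lambda>\<xi>. ball \<xi> (d \<xi> / 80)"
  have d_cont: "continuous_on S d" for S unfolding d_def by (intro continuous_intros)
  have [measurable]: "d \<in> borel_measurable borel" "\<Omega> \<in> sets borel"
    using d_cont \<Omega> by (auto intro!: borel_measurable_continuous_onI)
  have [measurable]: "?b i \<in> sets borel" for i by simp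
  have d_pos: "0 < d \<xi>" if "\<xi> \<in> \<Omega>" for \<xi>
    unfolding d_def by (rule infdist_frontier_pos[OF \<Omega> that])
  have in_\<Omega>: "cball \<xi> r \<subseteq> \<Omega>" if "\<xi> \<in> \<Omega>" "r < d \<xi>" for \<xi> r
    using that cball_subset_of_infdist_frontier unfolding d_def by blast
  have K: "compact ?K" "connected ?K" "x0 \<in> ?K" "x \<in> ?K"
    using \<gamma> by (auto simp: compact_path_image connected_path_image)
  \<comment> \<open>Radius \<open>d \<xi> / 80\<close> for the disjoint balls, so that five times it is \<open>d \<xi> / 16\<close>.\<close>
  obtain B where B: "\<And>\<xi>. \<xi> \<in> ?K \<Longrightarrow> d \<xi> \<le> B"
    using continuous_attains_sup[OF K(1) _ d_cont] K(3) by (metis empty_iff)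
  obtain C where C: "C \<subseteq> ?K" "pairwise (\<lambda>i j. disjnt (?b i) (?b j)) C"
      "?K \<subseteq> (\<Union>i\<in>C. ball i (5 * (d i / 80)))"
  proof (rule Vitali_covering_lemma_balls[of ?K "\<lambda>\<xi>. \<xi>" "\<lambda>\<xi>. d \<xi> / 80" ?K "B / 80"])
    show "?K \<subseteq> (\<Union>i\<in>?K. ?b i)" using d_pos \<gamma>(2) by force
    show "0 < d i / 80 \<and> d i / 80 \<le> B / 80" if "i \<in> ?K" for i
      using that d_pos[of i] B[of i] \<gamma>(2) by auto
  qed blast
  obtain E where E: "E \<subseteq> C" "finite E" "?K \<subseteq> (\<Union>i\<in>E. ball i (5 * (d i / 80)))"
    using compactE_image[OF K(1) _ C(3)] by auto
  have E_\<Omega>: "i \<in> \<Omega>" if "i \<in> E" for i using that E C \<gamma> by auto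
  define a where "a i = (INF y\<in>?b i. G y)" for i
  have osc_a: "ennreal \<bar>v z - v i\<bar> \<le> a i" if "i \<in> E" "dist i z \<le> d i / 16" for i z
    unfolding a_def by (rule INF_greatest) (use osc that E_\<Omega> in auto)

  have "ennreal \<bar>v x - v x0\<bar> \<le> (\<Sum>i\<in>E. 2 * a i)"
  proof -
    let ?V = "\<lambda>i. v ` cball i (d i / 16)"
    have V_borel: "?V i \<in> sets lborel" if "i \<in> E" for i
    proof -
      have "cball i (d i / 16) \<subseteq> \<Omega>" using in_\<Omega> E_\<Omega>[OF that] d_pos by simp
      then have "compact (?V i)" by (intro compact_continuous_image continuous_on_subset[OF v]) auto
      then show ?thesis by (simp add: borel_compact)
    qed
    have V_small: "emeasure lborel (?V i) \<le> 2 * a i" if "i \<in> E" for i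
    proof (cases "a i = top")
      case False
      then obtain s where s: "a i = ennreal s" "0 \<le> s" by (cases "a i") auto
      have "?V i \<subseteq> {v i - s .. v i + s}"
      proof (rule image_subsetI)
        fix z assume "z \<in> cball i (d i / 16)"
        then have "\<bar>v z - v i\<bar> \<le> s" using osc_a[OF that, of z] s by simp
        then show "v z \<in> {v i - s .. v i + s}" unfolding atLeastAtMost_iff by linarith
      qed
      then have "emeasure lborel (?V i) \<le> emeasure lborel {v i - s .. v i + s}"
        by (intro emeasure_mono) auto
      also have "\<dots> = 2 * a i" using s by (simp add: ennreal_mult flip: mult_2)
      finally show ?thesis .
    qed (simp add: ennreal_mult_top)
    have v_K: "connected (v ` ?K)"
      using K \<gamma>(2) v by (intro connected_continuous_image continuous_on_subset[OF v]) auto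
    have "{min (v x) (v x0)..max (v x) (v x0)} \<subseteq> v ` ?K"
      using K by (intro connected_contains_Icc[OF v_K]) (auto simp: min_def max_def)
    also have "\<dots> \<subseteq> (\<Union>i\<in>E. ?V i)"
    proof
      fix s assume "s \<in> v ` ?K"
      then obtain \<xi> where \<xi>: "\<xi> \<in> ?K" "s = v \<xi>" by auto
      then obtain i where "i \<in> E" "dist i \<xi> < 5 * (d i / 80)" using E(3) by auto
      then show "s \<in> (\<Union>i\<in>E. ?V i)" using \<xi> by (intro UN_I[of i] image_eqI[of _ _ \<xi>]) auto
    qed
    finally have "emeasure lborel {min (v x) (v x0)..max (v x) (v x0)} \<le> emeasure lborel (\<Union>i\<in>E. ?V i)"
      using V_borel E(2) by (intro emeasure_mono sets.finite_UN) auto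
    also have "\<dots> \<le> (\<Sum>i\<in>E. emeasure lborel (?V i))"
      using V_borel E(2) by (intro emeasure_subadditive_finite) auto
    also have "\<dots> \<le> (\<Sum>i\<in>E. 2 * a i)" by (intro sum_mono V_small)
    finally show ?thesis by (simp add: min_def max_def abs_if split: if_splits)
  qed
  also have "\<dots> = 2 * (\<Sum>i\<in>E. a i)" by (simp add: sum_distrib_left)
  also have "(\<Sum>i\<in>E. a i) \<le> (\<Sum>i\<in>E. ?c * (\<integral>\<^sup>+y\<in>?b i. kernel d ?D x y * G y \<partial>\<nu>))"
  proof (intro sum_mono)
    fix i assume i: "i \<in> E"
    note d_pos[OF E_\<Omega>[OF i]]
    let ?m = "measure \<nu> (cball i (d i / 160))"
    \<comment> \<open>Half the radius, to have a closed ball inside the open one.\<close>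
    have m: "0 < ?m" by (rule cball_pos) (use \<open>0 < d i\<close> in simp)
    have pointwise: "ennreal (1 / ?m) * a i \<le> ?c * (kernel d ?D x y * G y)" if y: "y \<in> ?b i" for y
    proof -
      have "\<bar>d i - d y\<bar> \<le> d i / 80"
        using y infdist_triangle_abs[of i "frontier \<Omega>" y] by (simp add: d_def)
      then have dy: "79 / 80 * d i \<le> d y" "d y \<le> 81 / 80 * d i" by linarith+
      have "dist x y \<le> dist x i + dist i y" by (rule dist_triangle)
      also have "\<dots> \<le> d i / \<delta> + d i / 80"
        using john[of i] i E(1) C(1) y \<delta> by (intro add_mono) (auto simp: field_simps dist_commute)
      also have "\<dots> \<le> 2 * d y / \<delta> + d y"
        using dy \<open>0 < d i\<close> \<delta> by (intro add_mono divide_right_mono) auto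
      finally have xy: "dist x y \<le> ?D * d y" by (simp add: algebra_simps)
      have "cball i (d i / 160) \<subseteq> cball y (d y)"
      proof
        fix w assume "w \<in> cball i (d i / 160)"
        then show "w \<in> cball y (d y)"
          using dist_triangle3[of y w i] y dy \<open>0 < d i\<close> unfolding mem_cball mem_ball by linarith
      qed
      then have "measure \<nu> (cball y (d y)) \<le> A * (d y / (d i / 160)) powr \<kappa> * ?m"
        using \<open>0 < d i\<close> by (intro doubling) auto
      also have "\<dots> \<le> A * 162 powr \<kappa> * ?m"
        using constant_ge_1 dy \<open>0 < d i\<close> exponent_pos
        by (intro mult_right_mono mult_left_mono powr_mono2) (auto simp: divide_simps)
      finally have "1 / ?m \<le> A * 162 powr \<kappa> * (1 / measure \<nu> (cball y (d y)))"
        using m cball_pos[of "d y" y] \<open>0 < d i\<close> dy by (simp add: divide_simps mult.commute)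
      then have "ennreal (1 / ?m) \<le> ennreal (A * 162 powr \<kappa> * (1 / measure \<nu> (cball y (d y))))"
        by (rule ennreal_leI)
      also have "\<dots> = ?c * kernel d ?D x y"
        using xy constant_ge_1 by (subst ennreal_mult) (auto simp: kernel_def)
      finally have "ennreal (1 / ?m) * a i \<le> (?c * kernel d ?D x y) * G y"
        using y by (intro mult_mono) (auto simp: a_def intro: INF_lower)
      then show ?thesis by (simp add: mult.assoc)
    qed
    have "ennreal (1 / ?m) * a i * ennreal ?m = ennreal (1 / ?m) * ennreal ?m * a i"
      by (simp only: ac_simps)
    also have "ennreal (1 / ?m) * ennreal ?m = 1"
      using m by (simp flip: ennreal_mult)
    finally have "a i = ennreal (1 / ?m) * a i * ennreal ?m" by simp
    also have "\<dots> = (\<integral>\<^sup>+y. ennreal (1 / ?m) * a i * indicator (cball i (d i / 160)) y \<partial>\<nu>)"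
      by (subst nn_integral_cmult_indicator) (auto simp: emeasure_cball sets_borel)
    also have "\<dots> \<le> (\<integral>\<^sup>+y. ?c * (kernel d ?D x y * G y * indicator (?b i) y) \<partial>\<nu>)"
    proof (intro nn_integral_mono)
      fix y
      show "ennreal (1 / ?m) * a i * indicator (cball i (d i / 160)) y
          \<le> ?c * (kernel d ?D x y * G y * indicator (?b i) y)"
        using pointwise[of y] \<open>0 < d i\<close> by (auto simp: indicator_def)
    qed
    also have "\<dots> = ?c * (\<integral>\<^sup>+y\<in>?b i. kernel d ?D x y * G y \<partial>\<nu>)"
      by (rule nn_integral_cmult) measurable
    finally show "a i \<le> \<dots>" .
  qed
  also have "\<dots> = ?c * (\<integral>\<^sup>+y. (\<Sum>i\<in>E. kernel d ?D x y * G y * indicator (?b i) y) \<partial>\<nu>)"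
  proof -
    have "(\<integral>\<^sup>+y. (\<Sum>i\<in>E. kernel d ?D x y * G y * indicator (?b i) y) \<partial>\<nu>)
        = (\<Sum>i\<in>E. \<integral>\<^sup>+y. kernel d ?D x y * G y * indicator (?b i) y \<partial>\<nu>)"
      by (rule nn_integral_sum) measurable
    then show ?thesis by (simp add: sum_distrib_left)
  qed
  also have "\<dots> \<le> ?c * (\<integral>\<^sup>+y\<in>\<Omega>. kernel d ?D x y * G y \<partial>\<nu>)"
  proof (intro mult_left_mono nn_integral_mono)
    fix y
    have "(\<Sum>i\<in>E. indicator (?b i) y) = (indicator (\<Union>i\<in>E. ?b i) y :: ennreal)"
      using C(2) E by (intro indicator_UN_disjoint[symmetric])
        (auto simp: disjoint_family_on_def pairwise_def disjnt_def dest: subsetD)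
    also have "\<dots> \<le> indicator \<Omega> y"
    proof -
      have "?b i \<subseteq> \<Omega>" if "i \<in> E" for i
        using in_\<Omega>[OF E_\<Omega>[OF that], of "d i / 80"] d_pos[OF E_\<Omega>[OF that]] by auto
      then have "(\<Union>i\<in>E. ?b i) \<subseteq> \<Omega>" by blast
      then have "y \<in> (\<Union>i\<in>E. ?b i) \<Longrightarrow> y \<in> \<Omega>" by (rule subsetD)
      then show ?thesis by (simp add: indicator_def del: UN_iff)
    qed
    finally show "(\<Sum>i\<in>E. kernel d ?D x y * G y * indicator (?b i) y) \<le> kernel d ?D x y * G y * indicator \<Omega> y"
      by (subst sum_distrib_left[symmetric]) (rule mult_left_mono, auto)
  qed auto
  finally show ?thesis by (simp add: mult_left_mono)
qed


text \<open>
  A Poincare inequality for John domains in \<open>L\<^sup>1\<close>: if the local oscillation of \<open>v\<close> is controlled by averages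
  of \<open>W\<close>, then the integral of \<open>v\<close> is controlled by that of \<open>W\<close>. The kernel is used twice, once to pass from
  Whitney balls to points and once for the curves. The exponent \<open>1\<close> is essential to the simplicity of the
  argument, as everything is linear in \<open>W\<close> and Tonelli's theorem replaces maximal functions.
\<close>
lemma john_integral_le:
  fixes v :: "'a \<Rightarrow> real"
  assumes \<Omega>: "open \<Omega>" "\<Omega> \<noteq> UNIV" and \<delta>: "0 < \<delta>"
  defines "d \<equiv> \<lambda>x. infdist x (frontier \<Omega>)"
  assumes john: "\<And>x. x \<in> \<Omega> \<Longrightarrow> \<exists>\<gamma>. path \<gamma> \<and> path_image \<gamma> \<subseteq> \<Omega> \<and> pathstart \<gamma> = x0 \<and> pathfinish \<gamma> = x \<and>
                    (\<forall>\<xi>\<in>path_image \<gamma>. \<delta> * dist \<xi> x \<le> d \<xi>)"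
    and v: "continuous_on \<Omega> v" "v x0 = 0" and W [measurable]: "W \<in> borel_measurable borel"
    and osc: "\<And>\<xi> z. \<lbrakk>\<xi> \<in> \<Omega>; dist \<xi> z \<le> d \<xi> / 16\<rbrakk> \<Longrightarrow>
                ennreal (\<bar>v z - v \<xi>\<bar> * measure \<nu> (cball \<xi> (d \<xi> / 4))) \<le> (\<integral>\<^sup>+u\<in>cball \<xi> (d \<xi> / 4). W u \<partial>\<nu>)"
  shows "(\<integral>\<^sup>+x\<in>\<Omega>. ennreal \<bar>v x\<bar> \<partial>\<nu>)
           \<le> ennreal (2 * A ^ 4 * (810 * (2 / \<delta> + 1)) powr \<kappa>) * (\<integral>\<^sup>+x\<in>\<Omega>. W x \<partial>\<nu>)"
proof -
  interpret sigma_finite_measure \<nu> by (rule sigma_finite)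
  have [measurable]: "d \<in> borel_measurable borel" "\<Omega> \<in> sets borel"
    unfolding d_def using \<Omega> by (auto intro!: borel_measurable_continuous_onI continuous_intros)
  have d_pos: "0 < d \<xi>" if "\<xi> \<in> \<Omega>" for \<xi>
    unfolding d_def by (rule infdist_frontier_pos[OF \<Omega> that])
  define D where "D = 2 / \<delta> + 1"
  have D: "1 \<le> D" using \<delta> by (simp add: D_def)
  note A = constant_ge_1
  define G where "G y = ennreal (A * 5 powr \<kappa>) * (\<integral>\<^sup>+u\<in>\<Omega>. kernel d 1 y u * W u \<partial>\<nu>)" for y
  have [measurable]: "G \<in> borel_measurable borel" unfolding G_def by measurable
  let ?J = "\<integral>\<^sup>+x\<in>\<Omega>. W x \<partial>\<nu>"
  have osc_G: "ennreal \<bar>v z - v \<xi>\<bar> \<le> G y"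
    if \<xi>: "\<xi> \<in> \<Omega>" and z: "dist \<xi> z \<le> d \<xi> / 16" and y: "dist \<xi> y < d \<xi> / 80" for \<xi> y z
  proof -
    let ?m = "measure \<nu> (cball \<xi> (d \<xi> / 4))"
    have m: "0 < ?m" using d_pos[OF \<xi>] by (intro cball_pos) simp
    have "ennreal \<bar>v z - v \<xi>\<bar> = ennreal (1 / ?m) * ennreal (\<bar>v z - v \<xi>\<bar> * ?m)"
      using m by (subst ennreal_mult[symmetric]) auto
    also have "\<dots> \<le> ennreal (1 / ?m) * (\<integral>\<^sup>+u\<in>cball \<xi> (d \<xi> / 4). W u \<partial>\<nu>)"
      using osc[OF \<xi> z] by (rule mult_left_mono) simp
    also have "\<dots> \<le> G y"
      unfolding G_def d_def using y by (intro average_le_kernel \<Omega> \<xi> W) (simp add: d_def)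
    finally show ?thesis .
  qed
  have "(\<integral>\<^sup>+x\<in>\<Omega>. ennreal \<bar>v x\<bar> \<partial>\<nu>)
      \<le> (\<integral>\<^sup>+x. 2 * ennreal (A * 162 powr \<kappa>) * ((\<integral>\<^sup>+y\<in>\<Omega>. kernel d D x y * G y \<partial>\<nu>) * indicator \<Omega> x) \<partial>\<nu>)"
  proof (intro nn_integral_mono)
    fix x
    show "ennreal \<bar>v x\<bar> * indicator \<Omega> x
        \<le> 2 * ennreal (A * 162 powr \<kappa>) * ((\<integral>\<^sup>+y\<in>\<Omega>. kernel d D x y * G y \<partial>\<nu>) * indicator \<Omega> x)"
    proof (cases "x \<in> \<Omega>")
      case True
      then obtain \<gamma> where \<gamma>: "path \<gamma>" "path_image \<gamma> \<subseteq> \<Omega>" "pathstart \<gamma> = x0" "pathfinish \<gamma> = x"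
        "\<And>\<xi>. \<xi> \<in> path_image \<gamma> \<Longrightarrow> \<delta> * dist \<xi> x \<le> d \<xi>"
        using john by blast
      have "ennreal \<bar>v x - v x0\<bar>
          \<le> 2 * (ennreal (A * 162 powr \<kappa>) * (\<integral>\<^sup>+y\<in>\<Omega>. kernel d D x y * G y \<partial>\<nu>))"
        unfolding d_def D_def
        by (rule path_oscillation_le_kernel[OF \<Omega> \<delta> \<gamma>(1-4) _ v(1)])
           (use \<gamma>(5) osc_G in \<open>auto simp: d_def\<close>)
      then show ?thesis using True v(2) by (simp add: mult.assoc)
    qed simp
  qed
  also have "\<dots> = 2 * ennreal (A * 162 powr \<kappa>) * (\<integral>\<^sup>+x\<in>\<Omega>. (\<integral>\<^sup>+y\<in>\<Omega>. kernel d D x y * G y \<partial>\<nu>) \<partial>\<nu>)"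
    by (rule nn_integral_cmult) measurable
  also have "\<dots> \<le> 2 * ennreal (A * 162 powr \<kappa>) * (ennreal (A * D powr \<kappa>) * (\<integral>\<^sup>+y\<in>\<Omega>. G y \<partial>\<nu>))"
    using D d_pos by (intro mult_left_mono kernel_integral_le) auto
  also have "(\<integral>\<^sup>+y\<in>\<Omega>. G y \<partial>\<nu>)
      = ennreal (A * 5 powr \<kappa>) * (\<integral>\<^sup>+y\<in>\<Omega>. (\<integral>\<^sup>+u\<in>\<Omega>. kernel d 1 y u * W u \<partial>\<nu>) \<partial>\<nu>)"
    unfolding G_def mult.assoc by (rule nn_integral_cmult) measurable
  also have "2 * ennreal (A * 162 powr \<kappa>) * (ennreal (A * D powr \<kappa>) * \<dots>)
      \<le> 2 * ennreal (A * 162 powr \<kappa>) * (ennreal (A * D powr \<kappa>) *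
          (ennreal (A * 5 powr \<kappa>) * (ennreal (A * 1 powr \<kappa>) * ?J)))"
    using d_pos by (intro mult_left_mono kernel_integral_le) auto
  also have "\<dots> = ennreal (2 * (A * 162 powr \<kappa>) * (A * D powr \<kappa>) * (A * 5 powr \<kappa>) * A) * ?J"
    using A by (simp add: ennreal_mult mult.assoc)
  also have "2 * (A * 162 powr \<kappa>) * (A * D powr \<kappa>) * (A * 5 powr \<kappa>) * A = 2 * A ^ 4 * (810 * D) powr \<kappa>"
  proof -
    have "(810 * D) powr \<kappa> = 162 powr \<kappa> * 5 powr \<kappa> * D powr \<kappa>"
      using D by (simp flip: powr_mult)
    then show ?thesis by (simp add: eval_nat_numeral)
  qed
  finally show ?thesis by (simp add: D_def)
qed

end

section \<open>Deviation of the holomorphic part for doubling measures\<close>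

lemma holomorphic_Cn_on_const: "holomorphic_Cn_on (\<lambda>_. c) S"
  unfolding holomorphic_Cn_on_def by (intro ballI exI[of _ "\<lambda>_. 0"]) auto

lemma holomorphic_Cn_on_diff_const:
  assumes "holomorphic_Cn_on h S"
  shows "holomorphic_Cn_on (\<lambda>z. h z - c) S"
  unfolding holomorphic_Cn_on_def
proof
  fix z assume "z \<in> S"
  then obtain h' where "(h has_derivative h') (at z)" "\<forall>c v. h' (c *s v) = c * h' v"
    using assms unfolding holomorphic_Cn_on_def by blast
  then show "\<exists>f'. ((\<lambda>z. h z - c) has_derivative f') (at z) \<and> (\<forall>c v. f' (c *s v) = c * f' v)"
    using has_derivative_diff[OF _ has_derivative_const, of h h' "at z" c] by (intro exI[of _ h']) simp
qed

lemma holomorphic_Cn_on_imp_continuous_on: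
  assumes "holomorphic_Cn_on h S" shows "continuous_on S h"
  using assms unfolding holomorphic_Cn_on_def
  by (meson continuous_at_imp_continuous_on has_derivative_continuous)

lemma pluriharmonic_oscillation:
  fixes h g :: "complex ^ 'n \<Rightarrow> complex"
  assumes h: "holomorphic_Cn_on h S" and g: "holomorphic_Cn_on g S" and sub: "cball z \<rho> \<subseteq> S"
    and m: "\<And>w. w \<in> cball z \<rho> \<Longrightarrow> norm (h w + cnj (g w)) \<le> m"
    and w: "dist z w \<le> t * \<rho>" and t: "t \<le> 1 / 2" and \<rho>: "0 < \<rho>"
  shows "norm ((h w + cnj (g w)) - (h z + cnj (g z))) \<le> 24 * t * m"
proof -
  have "norm (g w + cnj (h w)) = norm (h w + cnj (g w))" for w
    using complex_mod_cnj[of "h w + cnj (g w)"] by (simp add: add.commute)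
  then have "norm (g w - g z) \<le> 12 * t * m"
    using m by (intro holomorphic_part_oscillation[OF g h sub _ w t \<rho>]) auto
  moreover have "norm (h w - h z) \<le> 12 * t * m"
    by (rule holomorphic_part_oscillation[OF h g sub m w t \<rho>])
  moreover have "norm ((h w + cnj (g w)) - (h z + cnj (g z))) \<le> norm (h w - h z) + norm (cnj (g w - g z))"
    using norm_triangle_ineq[of "h w - h z" "cnj (g w - g z)"] by (simp add: algebra_simps)
  ultimately show ?thesis unfolding complex_mod_cnj by linarith
qed

lemma pluriharmonic_powr_le_average:
  fixes h g :: "complex ^ 'n \<Rightarrow> complex"
  assumes "doubling_measure \<nu> A \<kappa>"
    and h: "holomorphic_Cn_on h S" and g: "holomorphic_Cn_on g S" and sub: "cball \<xi> R \<subseteq> S"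
    and R: "0 < R" and p: "0 < p" and w: "dist \<xi> w \<le> R / 2"
  shows "ennreal (norm (h w + cnj (g w)) powr p * measure \<nu> (cball \<xi> R))
           \<le> ennreal (2 powr p * A * (192 * 2 powr (\<kappa> / p)) powr \<kappa>)
              * (\<integral>\<^sup>+u\<in>cball \<xi> R. ennreal (norm (h u + cnj (g u)) powr p) \<partial>\<nu>)"
proof -
  interpret doubling_measure \<nu> A \<kappa> by fact
  have "continuous_on (cball \<xi> R) (\<lambda>u. h u + cnj (g u))"
    using sub holomorphic_Cn_on_imp_continuous_on[OF h] holomorphic_Cn_on_imp_continuous_on[OF g]
    by (intro continuous_intros) (auto intro: continuous_on_subset)
  then have "ennreal (norm (h w + cnj (g w)) powr p * measure \<nu> (cball \<xi> R))
      \<le> ennreal (2 powr p * A * (8 * 24 * 2 powr (\<kappa> / p)) powr \<kappa>)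
              * (\<integral>\<^sup>+u\<in>cball \<xi> R. ennreal (norm (h u + cnj (g u)) powr p) \<partial>\<nu>)"
    using pluriharmonic_oscillation[OF h g order_trans[OF _ sub]]
    by (intro norm_powr_le_average[OF _ R p _ _ w]) auto
  then show ?thesis by simp
qed

lemma powr_ge_one_minus_mult:
  assumes "1 \<le> p" "0 \<le> x" "x \<le> 1"
  shows "1 - p * x \<le> (1 - x) powr (p :: real)"
proof (cases "x = 1")
  case False
  then have "((1 - x) powr p) powr (1 / p) * 1 powr (1 - 1 / p) \<le> 1 / p * (1 - x) powr p + (1 - 1 / p) * 1"
    using assms by (intro Youngs_inequality_0) auto
  then have "1 - x \<le> 1 / p * (1 - x) powr p + (1 - 1 / p)"
    using assms by (simp add: powr_powr)
  then have "p * (1 - x) \<le> p * (1 / p * (1 - x) powr p + (1 - 1 / p))"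
    using assms by (intro mult_left_mono) auto
  also have "\<dots> = (1 - x) powr p + p - 1" using assms by (simp add: algebra_simps)
  finally show ?thesis by (simp add: algebra_simps)
qed (use assms in simp)

text \<open>
  A form of \<open>\<bar>a\<^sup>p - b\<^sup>p\<bar> \<le> p * max(a, b)\<^bsup>p-1\<^esup> * \<bar>a - b\<bar>\<close> in which the two factors are separated, with an
  arbitrarily small constant in front of the first. If \<open>\<bar>a - b\<bar>\<close> is at most \<open>\<epsilon>\<close> times the maximum, it is
  Bernoulli's inequality; otherwise the second term alone dominates.
\<close>
lemma abs_powr_diff_le:
  assumes p: "1 \<le> p" and \<epsilon>: "0 < \<epsilon>" and ab: "0 \<le> a" "0 \<le> (b :: real)"
  shows "\<bar>a powr p - b powr p\<bar> \<le> p * \<epsilon> * max a b powr p + \<epsilon> powr (- p) * \<bar>a - b\<bar> powr p"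
proof -
  have main: "a powr p - b powr p \<le> p * \<epsilon> * a powr p + \<epsilon> powr (- p) * (a - b) powr p \<and> b powr p \<le> a powr p"
    if ba: "b \<le> a" "0 \<le> b" for a b :: real
  proof (cases "a = 0")
    case False
    then have a: "0 < a" using ba by simp
    have nonneg: "0 \<le> p * \<epsilon> * a powr p" "0 \<le> \<epsilon> powr (- p) * (a - b) powr p"
      using p \<epsilon> by auto
    have "a powr p - b powr p \<le> p * \<epsilon> * a powr p + \<epsilon> powr (- p) * (a - b) powr p"
    proof (cases "a - b \<le> \<epsilon> * a")
      case True
      have "1 - p * ((a - b) / a) \<le> (1 - (a - b) / a) powr p"
        using ba a p by (intro powr_ge_one_minus_mult) auto
      also have "1 - (a - b) / a = b / a" using a by (simp add: diff_divide_distrib)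
      finally have "(1 - p * ((a - b) / a)) * a powr p \<le> b powr p"
        using a ba by (simp add: powr_divide pos_le_divide_eq)
      then have "a powr p - b powr p \<le> p * ((a - b) / a) * a powr p" by (simp add: algebra_simps)
      also have "\<dots> \<le> p * \<epsilon> * a powr p"
        using True a p by (intro mult_right_mono mult_left_mono) (auto simp: pos_divide_le_eq)
      finally show ?thesis using nonneg(2) by linarith
    next
      case False
      have "a powr p = \<epsilon> powr (- p) * (\<epsilon> * a) powr p"
        using \<epsilon> a by (simp add: powr_mult powr_minus)
      also have "\<dots> \<le> \<epsilon> powr (- p) * (a - b) powr p"
        using False \<epsilon> a p by (intro mult_left_mono powr_mono2) auto
      finally show ?thesis using nonneg(1) powr_ge_zero[of b p] by linarith
    qed
    then show ?thesis using ba p by (auto intro: powr_mono2)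
  qed (use ba in auto)
  show ?thesis
  proof (cases "b \<le> a")
    case True
    then show ?thesis using main[OF True ab(2)] by (simp add: max_def)
  next
    case False
    then show ?thesis using main[of a b] ab(1) by (simp add: max_def)
  qed
qed


lemma borel_measurable_continuous_on_ennreal:
  assumes "continuous_on S \<phi>" "S \<in> sets borel"
  shows "(\<lambda>u. ennreal (\<phi> u) * indicator S u) \<in> borel_measurable borel"
proof -
  have "(\<lambda>u. ennreal (indicator S u *\<^sub>R \<phi> u)) \<in> borel_measurable borel"
    using borel_measurable_continuous_on_indicator[OF assms(2,1)] by measurable
  then show ?thesis
    by (rule measurable_cong[THEN iffD1, rotated]) (auto simp: indicator_def)
qed

text \<open>
  The Poincare inequality in \<open>L\<^sup>1\<close> is applied to \<open>v = norm (h - h x0) powr p\<close>. Locally, \<open>v\<close> oscillates by at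
  most a small multiple of the average of \<open>v\<close> itself plus a large multiple of the average of
  \<open>norm (h + cnj g) powr p\<close>. Summed up, the first contribution is half of the left-hand side and can be
  absorbed there, since the left-hand side is finite by assumption.
\<close>
lemma holomorphic_deviation_integral_le:
  fixes h g :: "complex ^ 'n \<Rightarrow> complex"
  assumes dm: "doubling_measure \<nu> A \<kappa>" and p: "1 \<le> p"
    and \<Omega>: "open \<Omega>" "\<Omega> \<noteq> UNIV" "x0 \<in> \<Omega>" and \<delta>: "0 < \<delta>"
    and john: "\<And>x. x \<in> \<Omega> \<Longrightarrow> \<exists>\<gamma>. path \<gamma> \<and> path_image \<gamma> \<subseteq> \<Omega> \<and> pathstart \<gamma> = x0 \<and> pathfinish \<gamma> = x \<and>
                    (\<forall>\<xi>\<in>path_image \<gamma>. \<delta> * dist \<xi> x \<le> infdist \<xi> (frontier \<Omega>))"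
    and h: "holomorphic_Cn_on h \<Omega>" and g: "holomorphic_Cn_on g \<Omega>"
    and fin: "(\<integral>\<^sup>+z\<in>\<Omega>. ennreal (norm (h z - h x0) powr p) \<partial>\<nu>) < \<infinity>"
  defines "B \<equiv> 2 powr p * A * (192 * 2 powr (\<kappa> / p)) powr \<kappa>"
    and "K \<equiv> 2 * A ^ 4 * (810 * (2 / \<delta> + 1)) powr \<kappa>"
  shows "(\<integral>\<^sup>+z\<in>\<Omega>. ennreal (norm (h z - h x0) powr p) \<partial>\<nu>)
           \<le> ennreal (2 * K * B * (12 * p * K * B) powr p)
              * (\<integral>\<^sup>+z\<in>\<Omega>. ennreal (norm (h z + cnj (g z)) powr p) \<partial>\<nu>)"
proof -
  interpret doubling_measure \<nu> A \<kappa> by fact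
  note A = constant_ge_1
  define d where "d x = infdist x (frontier \<Omega>)" for x
  define c where "c = h x0"
  define f where "f z = h z + cnj (g z)" for z
  have "0 < 810 * (2 / \<delta> + 1)" using \<delta> by (intro mult_pos_pos add_pos_pos) auto
  then have "0 < (810 * (2 / \<delta> + 1)) powr \<kappa>" by simp
  then have BK: "0 < B" "0 < K" using A unfolding B_def K_def by (auto intro!: mult_pos_pos)
  \<comment> \<open>The choice of \<open>\<epsilon>\<close> makes the absorbed term exactly half of the left-hand side.\<close>
  define \<epsilon> where "\<epsilon> = 1 / (2 * K * p * B)"
  have \<epsilon>: "0 < \<epsilon>" "K * (p * \<epsilon> * B) = 1 / 2" using BK p by (auto simp: \<epsilon>_def)
  define E where "E = \<epsilon> powr (- p) * 6 powr p * B"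
  have E: "0 < E" using BK \<epsilon> by (simp add: E_def)
  define P where "P u = ennreal (norm (h u - c) powr p) * indicator \<Omega> u" for u
  define Q where "Q u = ennreal (norm (f u) powr p) * indicator \<Omega> u" for u
  define W where "W u = ennreal (p * \<epsilon> * B) * P u + ennreal E * Q u" for u
  have h_cont: "continuous_on \<Omega> h" and g_cont: "continuous_on \<Omega> g"
    using h g by (auto intro: holomorphic_Cn_on_imp_continuous_on)
  have \<phi>_cont: "continuous_on \<Omega> (\<lambda>u. norm (h u - c) powr p)" "continuous_on \<Omega> (\<lambda>u. norm (f u) powr p)"
    unfolding f_def using p by (intro continuous_on_powr' continuous_intros h_cont g_cont; simp)+
  have [measurable]: "P \<in> borel_measurable borel" "Q \<in> borel_measurable borel"
    unfolding P_def Q_def using \<phi>_cont \<Omega> by (auto intro!: borel_measurable_continuous_on_ennreal)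
  have [measurable]: "W \<in> borel_measurable borel" "\<Omega> \<in> sets borel"
    unfolding W_def using \<Omega> by auto
  have d_pos: "0 < d \<xi>" if "\<xi> \<in> \<Omega>" for \<xi>
    unfolding d_def by (rule infdist_frontier_pos[OF \<Omega>(1,2) that])

  have osc: "ennreal (\<bar>norm (h z - c) powr p - norm (h \<xi> - c) powr p\<bar> * measure \<nu> (cball \<xi> (d \<xi> / 4)))
      \<le> (\<integral>\<^sup>+u\<in>cball \<xi> (d \<xi> / 4). W u \<partial>\<nu>)"
    if \<xi>: "\<xi> \<in> \<Omega>" and z: "dist \<xi> z \<le> d \<xi> / 16" for \<xi> z
  proof -
    let ?R = "d \<xi> / 4"
    let ?B = "cball \<xi> ?R"
    let ?m = "measure \<nu> ?B"
    have [measurable]: "?B \<in> sets borel" by simp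
    have d\<xi>: "0 < d \<xi>" using d_pos[OF \<xi>] .
    have sub: "?B \<subseteq> \<Omega>"
      using \<xi> d\<xi> by (intro cball_subset_of_infdist_frontier) (auto simp: d_def)
    let ?P = "\<integral>\<^sup>+u\<in>?B. P u \<partial>\<nu>" and ?Q = "\<integral>\<^sup>+u\<in>?B. Q u \<partial>\<nu>"
    have P_eq: "?P = (\<integral>\<^sup>+u\<in>?B. ennreal (norm ((h u - c) + cnj 0) powr p) \<partial>\<nu>)"
      and Q_eq: "?Q = (\<integral>\<^sup>+u\<in>?B. ennreal (norm (h u + cnj (g u)) powr p) \<partial>\<nu>)"
      using sub by (auto simp: P_def Q_def f_def indicator_def intro!: nn_integral_cong)
    have S: "ennreal (norm (h w - c) powr p * ?m) \<le> ennreal B * ?P" if "dist \<xi> w \<le> ?R / 2" for w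
      unfolding P_eq B_def
      using pluriharmonic_powr_le_average[OF dm holomorphic_Cn_on_diff_const[OF h]
          holomorphic_Cn_on_const sub _ _ that, of p c 0] d\<xi> p by simp
    \<comment> \<open>The oscillation of \<open>h\<close> needs the supremum of \<open>f\<close> on a ball twice as large as the one containing \<open>z\<close>.\<close>
    obtain s where s: "s \<in> cball \<xi> (?R / 2)" "\<And>w. w \<in> cball \<xi> (?R / 2) \<Longrightarrow> norm (f w) \<le> norm (f s)"
    proof -
      have "continuous_on (cball \<xi> (?R / 2)) (\<lambda>w. norm (f w))"
        unfolding f_def using sub d\<xi> subset_cball[of "?R / 2" ?R \<xi>]
        by (intro continuous_intros continuous_on_subset[OF h_cont] continuous_on_subset[OF g_cont]) auto
      then show ?thesis using continuous_attains_sup[of "cball \<xi> (?R / 2)" "\<lambda>w. norm (f w)"] d\<xi> that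
        by (auto simp del: mem_cball)
    qed
    have T: "ennreal ((norm (h z - h \<xi>)) powr p * ?m) \<le> ennreal (6 powr p * B) * ?Q"
    proof -
      have "norm (h z - h \<xi>) \<le> 12 * (1 / 2) * norm (f s)"
      proof (rule holomorphic_part_oscillation[OF h g])
        show "cball \<xi> (?R / 2) \<subseteq> \<Omega>" using sub d\<xi> subset_cball[of "?R / 2" ?R \<xi>] by auto
      qed (use s z d\<xi> in \<open>auto simp: f_def\<close>)
      then have "norm (h z - h \<xi>) powr p * ?m \<le> 6 powr p * (norm (f s) powr p * ?m)"
        using p powr_mono2[of p "norm (h z - h \<xi>)" "6 * norm (f s)"]
        by (simp add: powr_mult mult_right_mono flip: mult.assoc)
      then have "ennreal (norm (h z - h \<xi>) powr p * ?m) \<le> ennreal (6 powr p) * ennreal (norm (f s) powr p * ?m)"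
        by (simp add: ennreal_leI flip: ennreal_mult)
      also have "\<dots> \<le> ennreal (6 powr p) * (ennreal B * ?Q)"
        unfolding Q_eq B_def f_def
        using pluriharmonic_powr_le_average[OF dm h g sub, of p s] s(1) d\<xi> p
        by (intro mult_left_mono) auto
      finally show ?thesis using BK by (simp add: ennreal_mult mult.assoc)
    qed
    let ?a = "norm (h z - c)" and ?b = "norm (h \<xi> - c)"
    have max: "ennreal (max ?a ?b powr p * ?m) \<le> ennreal B * ?P"
      using S[of z] S[of \<xi>] z d\<xi> by (simp add: max_def)
    have "\<bar>?a powr p - ?b powr p\<bar> \<le> p * \<epsilon> * max ?a ?b powr p + \<epsilon> powr (- p) * \<bar>?a - ?b\<bar> powr p"
      by (rule abs_powr_diff_le[OF p \<epsilon>(1)]) auto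
    also have "\<dots> \<le> p * \<epsilon> * max ?a ?b powr p + \<epsilon> powr (- p) * norm (h z - h \<xi>) powr p"
      using p norm_triangle_ineq3[of "h z - c" "h \<xi> - c"]
      by (intro add_left_mono mult_left_mono powr_mono2) auto
    finally have "\<bar>?a powr p - ?b powr p\<bar> * ?m
        \<le> (p * \<epsilon> * max ?a ?b powr p + \<epsilon> powr (- p) * norm (h z - h \<xi>) powr p) * ?m"
      by (rule mult_right_mono) simp
    also have "\<dots> = p * \<epsilon> * (max ?a ?b powr p * ?m) + \<epsilon> powr (- p) * (norm (h z - h \<xi>) powr p * ?m)"
      by (simp add: algebra_simps)
    finally have "ennreal (\<bar>?a powr p - ?b powr p\<bar> * ?m)
        \<le> ennreal (p * \<epsilon> * (max ?a ?b powr p * ?m) + \<epsilon> powr (- p) * (norm (h z - h \<xi>) powr p * ?m))"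
      by (rule ennreal_leI)
    also have "\<dots> = ennreal (p * \<epsilon>) * ennreal (max ?a ?b powr p * ?m)
        + ennreal (\<epsilon> powr (- p)) * ennreal (norm (h z - h \<xi>) powr p * ?m)"
      using p \<epsilon> by (simp add: ennreal_mult ennreal_plus)
    also have "\<dots> \<le> ennreal (p * \<epsilon>) * (ennreal B * ?P) + ennreal (\<epsilon> powr (- p)) * (ennreal (6 powr p * B) * ?Q)"
      by (intro add_mono mult_left_mono max T) auto
    also have "\<dots> = ennreal (p * \<epsilon> * B) * ?P + ennreal E * ?Q"
      using p \<epsilon> BK by (simp add: E_def ennreal_mult mult.assoc)
    also have "\<dots> = (\<integral>\<^sup>+u\<in>?B. W u \<partial>\<nu>)"
      unfolding W_def distrib_right mult.assoc
      by (subst nn_integral_add, (measurable)[2]) (simp add: nn_integral_cmult)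
    finally show ?thesis .
  qed

  let ?I = "\<integral>\<^sup>+z\<in>\<Omega>. ennreal (norm (h z - c) powr p) \<partial>\<nu>"
  let ?J = "\<integral>\<^sup>+z\<in>\<Omega>. ennreal (norm (f z) powr p) \<partial>\<nu>"
  have "?I \<le> ennreal K * (\<integral>\<^sup>+x\<in>\<Omega>. W x \<partial>\<nu>)"
    using john_integral_le[OF \<Omega>(1,2) \<delta> john \<phi>_cont(1) _ \<open>W \<in> _\<close>] osc p
    by (simp add: c_def d_def K_def)
  also have "(\<integral>\<^sup>+x\<in>\<Omega>. W x \<partial>\<nu>) = (\<integral>\<^sup>+x. ennreal (p * \<epsilon> * B) * P x + ennreal E * Q x \<partial>\<nu>)"
    by (intro nn_integral_cong) (simp add: W_def P_def Q_def indicator_def)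
  also have "\<dots> = ennreal (p * \<epsilon> * B) * ?I + ennreal E * ?J"
    unfolding P_def[symmetric] Q_def[symmetric]
    by (subst nn_integral_add, (measurable)[2]) (simp add: nn_integral_cmult)
  finally have absorb: "?I \<le> ennreal K * (ennreal (p * \<epsilon> * B) * ?I + ennreal E * ?J)" .
  have const: "2 * (K * E) = 2 * K * B * (12 * p * K * B) powr p"
  proof -
    have "\<epsilon> powr (- p) = (1 / \<epsilon>) powr p" using \<epsilon> by (simp add: powr_minus powr_divide field_simps)
    then have "\<epsilon> powr (- p) * 6 powr p = (1 / \<epsilon> * 6) powr p" using \<epsilon> by (simp only: powr_mult)
    also have "1 / \<epsilon> * 6 = 12 * p * K * B" by (simp add: \<epsilon>_def)
    finally have "\<epsilon> powr (- p) * 6 powr p = (12 * p * K * B) powr p" .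
    then show ?thesis by (simp add: E_def)
  qed
  have "?I \<le> ennreal (2 * (K * E)) * ?J"
  proof (cases "?J = top")
    case True
    then show ?thesis using BK E by (simp add: ennreal_mult_top)
  next
    case False
    obtain i where i: "?I = ennreal i" "0 \<le> i" using fin by (cases ?I) (auto simp: c_def)
    obtain j where j: "?J = ennreal j" "0 \<le> j" using False by (cases ?J) auto
    have "ennreal i \<le> ennreal (K * (p * \<epsilon> * B * i + E * j))"
      using absorb i j BK E \<epsilon> p by (simp add: ennreal_mult ennreal_plus)
    then have "i \<le> K * (p * \<epsilon> * B * i + E * j)"
      by (rule ennreal_le_iff[THEN iffD1, rotated]) (use i j BK E \<epsilon> p in auto)
    then have "i \<le> K * (p * \<epsilon> * B) * i + K * E * j"
      by (simp add: algebra_simps)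
    then have "i \<le> 2 * (K * E) * j" unfolding \<epsilon>(2) by simp
    then show ?thesis using i j BK E by (simp add: ennreal_leI flip: ennreal_mult)
  qed
  then show ?thesis unfolding const c_def f_def .
qed

section \<open>Muckenhoupt weights and weighted averages\<close>

lemma set_integral_pos:
  fixes f :: "'a::euclidean_space \<Rightarrow> real"
  assumes int: "set_integrable lebesgue Q f" and pos: "AE x in lebesgue. 0 < f x"
    and Q: "Q \<in> sets lebesgue" "emeasure lebesgue Q \<noteq> 0"
  shows "0 < (LINT x:Q|lebesgue. f x)"
proof -
  let ?F = "\<lambda>x. indicator Q x *\<^sub>R f x"
  have int': "integrable lebesgue ?F" using int by (simp add: set_integrable_def)
  have nonneg: "AE x in lebesgue. 0 \<le> ?F x" using pos by eventually_elim (simp add: indicator_def)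
  have "integral\<^sup>L lebesgue ?F \<noteq> 0"
  proof
    assume "integral\<^sup>L lebesgue ?F = 0"
    then have "AE x in lebesgue. ?F x = 0" using integral_nonneg_eq_0_iff_AE[OF int' nonneg] by simp
    with pos have "AE x in lebesgue. x \<notin> Q" by eventually_elim (auto simp: indicator_def)
    then have "Q \<in> null_sets lebesgue" using AE_iff_null_sets[OF Q(1)] by simp
    then show False using Q(2) by auto
  qed
  moreover have "0 \<le> integral\<^sup>L lebesgue ?F" by (rule integral_nonneg_AE[OF nonneg])
  ultimately show ?thesis by (simp add: set_lebesgue_integral_def)
qed

lemma emeasure_cball_neq_0: "0 < r \<Longrightarrow> emeasure lebesgue (cball (x :: 'a::euclidean_space) r) \<noteq> 0"
  using less_imp_neq[OF unit_ball_vol_pos[of "real DIM('a)"]] by (auto simp: emeasure_cball)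

lemma weighted_integral_nonneg:
  assumes "AE x in lebesgue. 0 < (\<omega> x :: real)" "\<And>x. 0 \<le> \<phi> x"
  shows "0 \<le> (LINT x:E|lebesgue. \<phi> x * \<omega> x)"
  unfolding set_lebesgue_integral_def
proof (rule integral_nonneg_AE)
  show "AE x in lebesgue. 0 \<le> indicat_real E x *\<^sub>R (\<phi> x * \<omega> x)"
    using assms(1) by eventually_elim (use assms(2) in \<open>simp add: indicator_def\<close>)
qed

lemma weight_measurable:
  assumes "weight \<omega>" shows "\<omega> \<in> borel_measurable lebesgue"
proof (rule borel_measurable_LIMSEQ_real)
  fix x
  show "(\<lambda>n. indicator (cball 0 (real n)) x *\<^sub>R \<omega> x) \<longlonglongrightarrow> \<omega> x"
  proof (rule tendsto_eventually)
    obtain N :: nat where "norm x \<le> real N" using real_arch_simple by blast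
    then show "\<forall>\<^sub>F n in sequentially. indicator (cball 0 (real n)) x *\<^sub>R \<omega> x = \<omega> x"
      by (intro eventually_sequentiallyI[of N]) (auto simp: indicator_def)
  qed
next
  fix n
  show "(\<lambda>x. indicator (cball 0 (real n)) x *\<^sub>R \<omega> x) \<in> borel_measurable lebesgue"
    using assms unfolding weight_def locally_integrable_def set_integrable_def
    by (intro borel_measurable_integrable) auto
qed

text \<open>
  The measure \<open>\<omega> d\<mu>\<close>, restricted to the Borel sets. A weight may be negative on a null set; \<open>ennreal\<close> cuts this off.
\<close>
definition weight_measure :: "('a::euclidean_space \<Rightarrow> real) \<Rightarrow> 'a measure" where
  "weight_measure \<omega> = distr (density lebesgue (\<lambda>x. ennreal (\<omega> x))) borel (\<lambda>x. x)"

lemma nn_integral_weight_measure: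
  assumes \<omega>: "weight \<omega>" and E: "(\<lambda>x. ennreal (\<phi> x) * indicator E x) \<in> borel_measurable borel"
    and int: "set_integrable lebesgue E (\<lambda>x. \<phi> x * \<omega> x)" and \<phi>: "\<And>x. 0 \<le> \<phi> x"
  shows "(\<integral>\<^sup>+x\<in>E. ennreal (\<phi> x) \<partial>weight_measure \<omega>) = ennreal (LINT x:E|lebesgue. \<phi> x * \<omega> x)"
proof -
  have [measurable]: "(\<lambda>x. ennreal (\<omega> x)) \<in> borel_measurable lebesgue"
    using weight_measurable[OF \<omega>] by measurable
  have pos: "AE x in lebesgue. 0 < \<omega> x" using \<omega> by (simp add: weight_def)
  have id: "(\<lambda>x. x) \<in> density lebesgue (\<lambda>x. ennreal (\<omega> x)) \<rightarrow>\<^sub>M borel"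
    by (simp add: measurable_def)
  have E': "(\<lambda>x. ennreal (\<phi> x) * indicator E x) \<in> borel_measurable lebesgue"
    using measurable_compose[OF _ E, of "\<lambda>x. x" lebesgue] by (simp add: measurable_def)
  have "(\<integral>\<^sup>+x\<in>E. ennreal (\<phi> x) \<partial>weight_measure \<omega>)
      = (\<integral>\<^sup>+x. ennreal (\<omega> x) * (ennreal (\<phi> x) * indicator E x) \<partial>lebesgue)"
    unfolding weight_measure_def using E E' by (simp add: nn_integral_distr[OF id] nn_integral_density)
  also have "\<dots> = (\<integral>\<^sup>+x. ennreal (indicator E x *\<^sub>R (\<phi> x * \<omega> x)) \<partial>lebesgue)"
  proof (rule nn_integral_cong_AE)
    show "AE x in lebesgue. ennreal (\<omega> x) * (ennreal (\<phi> x) * indicator E x)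
        = ennreal (indicator E x *\<^sub>R (\<phi> x * \<omega> x))"
      using pos by eventually_elim (use \<phi> in \<open>auto simp: indicator_def ennreal_mult mult.commute\<close>)
  qed
  also have "\<dots> = ennreal (LINT x:E|lebesgue. \<phi> x * \<omega> x)"
    unfolding set_lebesgue_integral_def
  proof (rule nn_integral_eq_integral)
    show "integrable lebesgue (\<lambda>x. indicat_real E x *\<^sub>R (\<phi> x * \<omega> x))"
      using int by (simp add: set_integrable_def)
    show "AE x in lebesgue. 0 \<le> indicat_real E x *\<^sub>R (\<phi> x * \<omega> x)"
      using pos by eventually_elim (use \<phi> in \<open>simp add: indicator_def\<close>)
  qed
  finally show ?thesis .
qed

text \<open>
  Hoelder's inequality for \<open>1 = \<omega>\<^bsup>1/q\<^esup> * \<omega>\<^bsup>-1/q\<^esup>\<close> on a ball \<open>E\<close> inside \<open>Q\<close> bounds \<open>\<bar>E\<bar>\<close> by the weight of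
  \<open>E\<close> and the integral of the dual weight over \<open>Q\<close>, and the Muckenhoupt condition trades the latter for the
  weight of \<open>Q\<close>. The result is that the weight of \<open>Q\<close> is at most \<open>M * (\<bar>Q\<bar> / \<bar>E\<bar>)\<^sup>q\<close> times that of \<open>E\<close>.
\<close>
lemma muckenhoupt_doubling:
  fixes \<omega> :: "'a::euclidean_space \<Rightarrow> real"
  assumes \<omega>: "muckenhoupt q M \<omega>" and q: "1 < q" and M: "1 \<le> M"
  shows "doubling_measure (weight_measure \<omega>) M (real DIM('a) * q)"
proof -
  have wt: "weight \<omega>" using \<omega> by (simp add: muckenhoupt_def)
  then have pos: "AE x in lebesgue. 0 < \<omega> x" by (simp add: weight_def)
  define w where "w S = (LINT x:S|lebesgue. \<omega> x)" for S
  have int_w: "set_integrable lebesgue (cball x r) \<omega>" for x r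
    using wt by (simp add: weight_def locally_integrable_def)
  have emeasure_w: "emeasure (weight_measure \<omega>) (cball x r) = ennreal (w (cball x r))" for x r
  proof -
    have "emeasure (weight_measure \<omega>) (cball x r) = (\<integral>\<^sup>+u\<in>cball x r. ennreal 1 \<partial>weight_measure \<omega>)"
      by (simp add: weight_measure_def)
    also have "\<dots> = ennreal (LINT u:cball x r|lebesgue. 1 * \<omega> u)"
      using int_w by (intro nn_integral_weight_measure wt) (auto intro!: borel_measurable_indicator)
    finally show ?thesis by (simp add: w_def)
  qed
  have w_pos: "0 < w (cball x r)" if "0 < r" for x r
    unfolding w_def by (rule set_integral_pos[OF int_w pos _ emeasure_cball_neq_0[OF that]]) simp
  have w_nonneg: "0 \<le> w (cball x r)" for x r
    using weighted_integral_nonneg[OF pos, of "\<lambda>_. 1"] by (simp add: w_def)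
  have measure_w: "measure (weight_measure \<omega>) (cball x r) = w (cball x r)" for x r
    using emeasure_w[of x r] w_nonneg by (simp add: measure_def)
  have dbl: "w (cball x R) \<le> M * (R / r) powr (real DIM('a) * q) * w (cball y r)"
    if r: "0 < r" and sub: "cball y r \<subseteq> cball x R" for x y r R
  proof -
    let ?Q = "cball x R" and ?E = "cball y r"
    let ?\<sigma> = "\<lambda>u. \<omega> u powr (1 / (1 - q))"
    have R: "0 < R"
      using sub r zero_le_dist[of y x] unfolding cball_subset_cball_iff by linarith
    have A_q: "set_integrable lebesgue ?Q ?\<sigma>"
        "w ?Q \<le> M * measure lebesgue ?Q powr q * (LINT u:?Q|lebesgue. ?\<sigma> u) powr (1 - q)"
      using \<omega> R unfolding muckenhoupt_def is_ball_def w_def by blast+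
    define Y where "Y = (LINT u:?Q|lebesgue. ?\<sigma> u)"
    define X where "X = w ?E"
    have \<sigma>_pos: "AE u in lebesgue. 0 < ?\<sigma> u" using pos by eventually_elim simp
    have Y: "0 < Y" unfolding Y_def by (rule set_integral_pos[OF A_q(1) \<sigma>_pos _ emeasure_cball_neq_0[OF R]]) simp
    have X: "0 < X" unfolding X_def by (rule w_pos[OF r])
    have int_E: "set_integrable lebesgue ?E ?\<sigma>" by (rule set_integrable_subset[OF A_q(1) _ sub]) simp
    have Y_E: "(LINT u:?E|lebesgue. ?\<sigma> u) \<le> Y"
      using A_q(1) int_E sub unfolding Y_def set_lebesgue_integral_def set_integrable_def
      by (intro integral_mono) (auto simp: indicator_def)
    let ?a = "1 / q" and ?b = "1 - 1 / q"
    let ?k = "(1 / X) powr ?a * (1 / Y) powr ?b"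
    have E: "?E \<in> sets lebesgue" "emeasure lebesgue ?E \<noteq> \<infinity>"
      by (simp_all add: emeasure_cball r less_imp_le)
    \<comment> \<open>Hoelder's inequality by integrating Young's inequality for the normalised functions.\<close>
    have "measure lebesgue ?E * ?k = (LINT u:?E|lebesgue. ?k)"
      using E by (simp add: set_integral_const)
    also have "\<dots> \<le> (LINT u:?E|lebesgue. ?a * (\<omega> u / X) + ?b * (?\<sigma> u / Y))"
    proof (rule set_integral_mono_AE)
      show "AE u\<in>?E in lebesgue. ?k \<le> ?a * (\<omega> u / X) + ?b * (?\<sigma> u / Y)"
        using pos
      proof eventually_elim
        case (elim u)
        have "\<omega> u powr ?a * ?\<sigma> u powr ?b = \<omega> u powr (?a + 1 / (1 - q) * ?b)"
          by (simp add: powr_powr powr_add)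
        also have "?a + 1 / (1 - q) * ?b = 0" using q by (simp add: field_simps)
        finally have one: "\<omega> u powr ?a * ?\<sigma> u powr ?b = 1" using elim by simp
        have "?k = (\<omega> u / X) powr ?a * (?\<sigma> u / Y) powr ?b"
          using one elim X Y by (simp add: powr_divide)
        also have "\<dots> \<le> ?a * (\<omega> u / X) + ?b * (?\<sigma> u / Y)"
          using q elim X Y by (intro Youngs_inequality_0) auto
        finally show ?case by simp
      qed
    qed (use int_w int_E in \<open>auto intro!: set_integral_add set_integrable_mult_right\<close>)
    also have "\<dots> = ?a * ((LINT u:?E|lebesgue. \<omega> u) / X) + ?b * ((LINT u:?E|lebesgue. ?\<sigma> u) / Y)"
      using int_w int_E by (subst set_integral_add) auto
    also have "\<dots> \<le> ?a * 1 + ?b * 1"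
      using X Y Y_E q by (intro add_mono mult_left_mono) (auto simp: X_def w_def)
    also have "\<dots> = 1" by simp
    finally have "measure lebesgue ?E \<le> X powr ?a * Y powr ?b"
      using X Y by (simp add: powr_divide field_simps)
    then have "measure lebesgue ?E powr q \<le> (X powr ?a * Y powr ?b) powr q"
      using q by (intro powr_mono2) auto
    also have "\<dots> = X * Y powr (q - 1)"
      using q X Y by (simp add: powr_mult powr_powr algebra_simps)
    finally have hoelder: "measure lebesgue ?E powr q * Y powr (1 - q) \<le> X"
      using Y by (simp add: powr_diff field_simps)
    let ?N = "real DIM('a)"
    have vol: "measure lebesgue ?Q = (R / r) powr ?N * measure lebesgue ?E"
      using r R by (simp add: content_cball powr_realpow power_divide)
    have "w ?Q \<le> M * measure lebesgue ?Q powr q * Y powr (1 - q)" using A_q(2) by (simp add: Y_def)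
    also have "\<dots> = M * (R / r) powr (?N * q) * (measure lebesgue ?E powr q * Y powr (1 - q))"
      unfolding vol using r R by (simp add: powr_mult powr_powr)
    also have "\<dots> \<le> M * (R / r) powr (?N * q) * X"
      using hoelder M by (intro mult_left_mono) auto
    finally show ?thesis by (simp add: X_def)
  qed
  show ?thesis
  proof
    show "sets (weight_measure \<omega>) = sets borel" by (simp add: weight_measure_def)
    show "0 < real DIM('a) * q" using q by simp
  qed (use emeasure_w w_pos dbl in \<open>auto simp: measure_w\<close>)
qed


lemma norm_add_powr_le:
  fixes a b :: "'a::real_normed_vector"
  assumes "0 \<le> p"
  shows "norm (a + b) powr p \<le> 2 powr p * (norm a powr p + norm b powr p)"
proof -
  have "norm (a + b) \<le> 2 * max (norm a) (norm b)" using norm_triangle_ineq[of a b] by linarith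
  then have "norm (a + b) powr p \<le> (2 * max (norm a) (norm b)) powr p"
    using assms by (intro powr_mono2) auto
  also have "\<dots> = 2 powr p * max (norm a) (norm b) powr p" by (simp add: powr_mult le_max_iff_disj)
  also have "\<dots> \<le> 2 powr p * (norm a powr p + norm b powr p)"
    by (intro mult_left_mono) (auto simp: max_def)
  finally show ?thesis .
qed

lemma set_integrable_norm_add_powr:
  fixes a b :: "'a::euclidean_space \<Rightarrow> complex"
  assumes \<omega>: "weight \<omega>" and \<Omega>: "open \<Omega>" and p: "0 < p"
    and cont: "continuous_on \<Omega> a" "continuous_on \<Omega> b"
    and int: "set_integrable lebesgue \<Omega> (\<lambda>x. norm (a x) powr p * \<omega> x)"
      "set_integrable lebesgue \<Omega> (\<lambda>x. norm (b x) powr p * \<omega> x)"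
  shows "set_integrable lebesgue \<Omega> (\<lambda>x. norm (a x + b x) powr p * \<omega> x)"
proof (rule set_integrable_bound)
  show "set_integrable lebesgue \<Omega> (\<lambda>x. 2 powr p * (norm (a x) powr p * \<omega> x + norm (b x) powr p * \<omega> x))"
    using int by (intro set_integrable_mult_right set_integral_add) auto
  have "continuous_on \<Omega> (\<lambda>x. norm (a x + b x) powr p)"
    using p by (intro continuous_on_powr' continuous_intros cont) auto
  then have "(\<lambda>x. indicator \<Omega> x *\<^sub>R (norm (a x + b x) powr p)) \<in> borel_measurable borel"
    using \<Omega> by (intro borel_measurable_continuous_on_indicator) auto
  then have "(\<lambda>x. indicator \<Omega> x *\<^sub>R (norm (a x + b x) powr p)) \<in> borel_measurable lebesgue"
    by (auto simp: measurable_def)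
  then have "(\<lambda>x. (indicator \<Omega> x *\<^sub>R (norm (a x + b x) powr p)) * \<omega> x) \<in> borel_measurable lebesgue"
    using weight_measurable[OF \<omega>] by (rule borel_measurable_times)
  then show "set_borel_measurable lebesgue \<Omega> (\<lambda>x. norm (a x + b x) powr p * \<omega> x)"
    by (simp add: set_borel_measurable_def mult.assoc)
  have "AE x in lebesgue. 0 < \<omega> x" using \<omega> by (simp add: weight_def)
  then show "AE x in lebesgue. x \<in> \<Omega> \<longrightarrow> norm (norm (a x + b x) powr p * \<omega> x)
      \<le> norm (2 powr p * (norm (a x) powr p * \<omega> x + norm (b x) powr p * \<omega> x))"
  proof eventually_elim
    case (elim x)
    then show ?case
      using mult_right_mono[OF norm_add_powr_le[of p "a x" "b x"], of "\<omega> x"] p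
      by (simp add: algebra_simps)
  qed
qed

text \<open>
  Up to the factor \<open>2\<^sup>p\<close> this is Jensen's inequality. The proof integrates
  \<open>y \<le> t + t\<^bsup>1-p\<^esup> * y\<^sup>p\<close>, taking for \<open>t\<close> half of the quantity to be estimated.
\<close>
lemma weighted_average_deviation:
  fixes h :: "'a::euclidean_space \<Rightarrow> complex"
  assumes \<omega>: "weight \<omega>" and \<Omega>: "open \<Omega>" "bounded \<Omega>" "\<Omega> \<noteq> {}" and p: "1 \<le> p"
    and h: "continuous_on \<Omega> h" and int: "set_integrable lebesgue \<Omega> (\<lambda>x. norm (h x - c) powr p * \<omega> x)"
  shows "norm (weighted_average \<Omega> \<omega> h - c) powr p * (LINT x:\<Omega>|lebesgue. \<omega> x)
           \<le> 2 powr p * (LINT x:\<Omega>|lebesgue. norm (h x - c) powr p * \<omega> x)"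
proof -
  have pos: "AE x in lebesgue. 0 < \<omega> x" using \<omega> by (simp add: weight_def)
  have \<Omega>_leb: "\<Omega> \<in> sets lebesgue" using \<Omega> by auto
  have int_\<omega>: "set_integrable lebesgue \<Omega> \<omega>"
  proof -
    have "set_integrable lebesgue (closure \<Omega>) \<omega>"
      using \<omega> \<Omega> by (simp add: weight_def locally_integrable_def compact_closure)
    then show ?thesis by (rule set_integrable_subset[OF _ \<Omega>_leb closure_subset])
  qed
  define w where "w = (LINT x:\<Omega>|lebesgue. \<omega> x)"
  define n where "n = (LINT x:\<Omega>|lebesgue. norm (h x - c) powr p * \<omega> x)"
  have w: "0 < w"
    unfolding w_def
  proof (rule set_integral_pos[OF int_\<omega> pos \<Omega>_leb])
    obtain x r where "0 < r" "cball x r \<subseteq> \<Omega>" using \<Omega> open_contains_cball by blast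
    then show "emeasure lebesgue \<Omega> \<noteq> 0"
      using emeasure_mono[of "cball x r" \<Omega> lebesgue] \<Omega>_leb emeasure_cball_neq_0[of r x] by auto
  qed
  have n: "0 \<le> n"
    unfolding n_def by (rule weighted_integral_nonneg[OF pos]) simp
  let ?u = "\<lambda>x. (h x - c) * of_real (\<omega> x)"
  have young: "norm z \<le> t + t powr (1 - p) * norm z powr p" if "0 < t" for t and z :: complex
  proof (cases "norm z \<le> t")
    case False
    then have "norm z = norm z powr (1 - p) * norm z powr p"
      using that by (simp flip: powr_add)
    also have "\<dots> \<le> t powr (1 - p) * norm z powr p"
      using False that p by (intro mult_right_mono powr_mono2') auto
    finally show ?thesis using that by simp
  qed (simp add: add_increasing2)
  have bound_int: "set_integrable lebesgue \<Omega> (\<lambda>x. t * \<omega> x + s * (norm (h x - c) powr p * \<omega> x))" for t s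
    using int int_\<omega> by (intro set_integral_add set_integrable_mult_right) auto
  have bound: "AE x in lebesgue. norm (?u x) \<le> t * \<omega> x + t powr (1 - p) * (norm (h x - c) powr p * \<omega> x)"
    if "0 < t" for t
    using pos
  proof eventually_elim
    case (elim x)
    then have "norm (?u x) = norm (h x - c) * \<omega> x" by (simp add: norm_mult)
    also have "\<dots> \<le> (t + t powr (1 - p) * norm (h x - c) powr p) * \<omega> x"
      using elim by (intro mult_right_mono young that) auto
    finally show ?case by (simp add: algebra_simps)
  qed
  have int_u: "set_integrable lebesgue \<Omega> ?u"
  proof (rule set_integrable_bound[OF bound_int[of 1 1]])
    have "(\<lambda>x. indicator \<Omega> x *\<^sub>R (h x - c)) \<in> borel_measurable borel"
      using \<Omega> h by (intro borel_measurable_continuous_on_indicator continuous_intros) auto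
    then have "(\<lambda>x. indicator \<Omega> x *\<^sub>R (h x - c)) \<in> borel_measurable lebesgue"
      by (auto simp: measurable_def)
    moreover have "(\<lambda>x. complex_of_real (\<omega> x)) \<in> borel_measurable lebesgue"
      using weight_measurable[OF \<omega>] by measurable
    ultimately have "(\<lambda>x. (indicator \<Omega> x *\<^sub>R (h x - c)) * of_real (\<omega> x)) \<in> borel_measurable lebesgue"
      by (rule borel_measurable_times)
    then show "set_borel_measurable lebesgue \<Omega> ?u" by (simp add: set_borel_measurable_def)
    show "AE x in lebesgue. x \<in> \<Omega> \<longrightarrow> norm (?u x) \<le> norm (1 * \<omega> x + 1 * (norm (h x - c) powr p * \<omega> x))"
      using bound[OF zero_less_one] by eventually_elim (auto intro: order_trans[OF _ abs_ge_self])
  qed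
  have int_c: "set_integrable lebesgue \<Omega> (\<lambda>x. c * of_real (\<omega> x))"
  proof -
    have "set_integrable lebesgue \<Omega> (\<lambda>x. complex_of_real (\<omega> x))"
      using int_\<omega> unfolding set_integrable_def by (auto dest: integrable_of_real simp: scaleR_conv_of_real)
    then show ?thesis by (rule set_integrable_mult_right)
  qed
  have "(LINT x:\<Omega>|lebesgue. h x * of_real (\<omega> x)) = (LINT x:\<Omega>|lebesgue. ?u x + c * of_real (\<omega> x))"
    by (simp add: algebra_simps)
  also have "\<dots> = (LINT x:\<Omega>|lebesgue. ?u x) + c * of_real w"
    using int_u int_c by (simp add: w_def set_integral_complex_of_real)
  finally have "(weighted_average \<Omega> \<omega> h - c) * of_real w = (LINT x:\<Omega>|lebesgue. ?u x)"
    using w by (simp add: weighted_average_def w_def[symmetric] field_simps)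
  then have dev: "norm (weighted_average \<Omega> \<omega> h - c) * w = norm (LINT x:\<Omega>|lebesgue. ?u x)"
    using w by (metis abs_of_pos norm_mult norm_of_real)
  define s where "s = norm (weighted_average \<Omega> \<omega> h - c)"
  have "s powr p * w \<le> 2 powr p * n"
  proof (cases "s = 0")
    case False
    then have s: "0 < s / 2" by (simp add: s_def)
    have "s * w \<le> (LINT x:\<Omega>|lebesgue. norm (?u x))"
      unfolding s_def dev by (rule set_integral_norm_bound[OF int_u])
    also have "\<dots> \<le> (LINT x:\<Omega>|lebesgue. s / 2 * \<omega> x + (s / 2) powr (1 - p) * (norm (h x - c) powr p * \<omega> x))"
    proof (rule set_integral_mono_AE[OF set_integrable_norm[OF int_u] bound_int])
      show "AE x\<in>\<Omega> in lebesgue. norm (?u x)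
          \<le> s / 2 * \<omega> x + (s / 2) powr (1 - p) * (norm (h x - c) powr p * \<omega> x)"
        using bound[OF s] by eventually_elim simp
    qed
    also have "\<dots> = s / 2 * w + (s / 2) powr (1 - p) * n"
      using int int_\<omega> by (subst set_integral_add) (auto simp: w_def n_def)
    finally have "s / 2 * w \<le> (s / 2) powr (1 - p) * n" by simp
    then have "(s / 2) powr (p - 1) * (s / 2 * w) \<le> (s / 2) powr (p - 1) * ((s / 2) powr (1 - p) * n)"
      by (intro mult_left_mono) auto
    also have "\<dots> = n" using s by (simp flip: mult.assoc powr_add)
    also have "(s / 2) powr (p - 1) * (s / 2 * w) = (s / 2) powr p * w"
      using s by (simp add: powr_diff)
    finally show ?thesis by (simp add: powr_divide field_simps)
  qed (use n p in simp)
  then show ?thesis by (simp add: s_def w_def n_def)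
qed


lemma john_domain_bounded:
  assumes "john_domain \<delta> \<Omega>" and \<delta>: "0 < \<delta>" shows "bounded \<Omega>"
proof -
  obtain x0 where john: "\<And>x. x \<in> \<Omega> \<Longrightarrow> \<exists>\<gamma>. pathstart \<gamma> = x0 \<and>
      (\<forall>\<xi>\<in>path_image \<gamma>. \<delta> * dist \<xi> x \<le> infdist \<xi> (frontier \<Omega>))"
    using assms(1) unfolding john_domain_def by blast
  have "dist x0 x \<le> infdist x0 (frontier \<Omega>) / \<delta>" if "x \<in> \<Omega>" for x
    using john[OF that] \<delta> by (auto simp: field_simps)
  then show ?thesis unfolding bounded_def by blast
qed

text \<open>
  Passes from the constant \<open>h x0\<close> to the weighted average, which is at least as good up to a factor.
\<close>
lemma holomorphic_part_Lp_norm_le: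
  fixes h g :: "complex ^ 'n \<Rightarrow> complex"
  assumes p: "1 \<le> p" and q: "1 < q" and M: "1 \<le> M" and \<delta>: "0 < \<delta>"
    and \<omega>: "muckenhoupt q M \<omega>" and \<Omega>: "john_domain \<delta> \<Omega>"
    and h: "holomorphic_Cn_on h \<Omega>" "in_Lp p \<Omega> \<omega> h" and g: "holomorphic_Cn_on g \<Omega>" "in_Lp p \<Omega> \<omega> g"
  defines "\<kappa> \<equiv> real DIM(complex ^ 'n) * q"
  defines "B \<equiv> 2 powr p * M * (192 * 2 powr (\<kappa> / p)) powr \<kappa>"
    and "K \<equiv> 2 * M ^ 4 * (810 * (2 / \<delta> + 1)) powr \<kappa>"
  shows "Lp_norm p \<Omega> \<omega> (\<lambda>z. h z - weighted_average \<Omega> \<omega> h)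
           \<le> (2 powr p * (1 + 2 powr p) * (2 * K * B * (12 * p * K * B) powr p)) powr (1 / p)
              * Lp_norm p \<Omega> \<omega> (\<lambda>z. h z + cnj (g z))"
proof -
  have wt: "weight \<omega>" using \<omega> by (simp add: muckenhoupt_def)
  then have pos: "AE x in lebesgue. 0 < \<omega> x" by (simp add: weight_def)
  note bdd = john_domain_bounded[OF \<Omega> \<delta>]
  have op: "open \<Omega>" "\<Omega> \<noteq> {}" "\<Omega> \<noteq> UNIV" using \<Omega> by (auto simp: john_domain_def)
  have h_cont: "continuous_on \<Omega> h" and g_cont: "continuous_on \<Omega> g"
    using h g by (auto intro: holomorphic_Cn_on_imp_continuous_on)
  obtain x0 where x0: "x0 \<in> \<Omega>" and john: "\<And>x. x \<in> \<Omega> \<Longrightarrow> \<exists>\<gamma>. path \<gamma> \<and> path_image \<gamma> \<subseteq> \<Omega> \<and> pathstart \<gamma> = x0 \<and> pathfinish \<gamma> = x \<and>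
        (\<forall>\<xi>\<in>path_image \<gamma>. \<delta> * dist \<xi> x \<le> infdist \<xi> (frontier \<Omega>))"
    using \<Omega> unfolding john_domain_def by blast
  define n where "n u = (LINT z:\<Omega>|lebesgue. norm (u z) powr p * \<omega> z)" for u :: "complex ^ 'n \<Rightarrow> complex"
  have n_nonneg: "0 \<le> n u" for u
    unfolding n_def by (rule weighted_integral_nonneg[OF pos]) simp
  have Lp: "Lp_norm p \<Omega> \<omega> u = n u powr (1 / p)" for u by (simp add: Lp_norm_def n_def)
  have int_const: "set_integrable lebesgue \<Omega> (\<lambda>x. norm c powr p * \<omega> x)" for c :: complex
  proof -
    have "set_integrable lebesgue (closure \<Omega>) \<omega>"
      using wt bdd by (simp add: weight_def locally_integrable_def compact_closure)
    then have "set_integrable lebesgue \<Omega> \<omega>"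
      using op by (rule_tac set_integrable_subset[OF _ _ closure_subset]) auto
    then show ?thesis by (rule set_integrable_mult_right)
  qed
  have int_h: "set_integrable lebesgue \<Omega> (\<lambda>x. norm (h x) powr p * \<omega> x)"
    and int_g: "set_integrable lebesgue \<Omega> (\<lambda>x. norm (cnj (g x)) powr p * \<omega> x)"
    using h(2) g(2) by (auto simp: in_Lp_def)
  have int_dev: "set_integrable lebesgue \<Omega> (\<lambda>x. norm (h x - c) powr p * \<omega> x)" for c
    using set_integrable_norm_add_powr[OF wt op(1) _ h_cont continuous_on_const int_h int_const, of "- c"] p
    by simp
  have int_f: "set_integrable lebesgue \<Omega> (\<lambda>x. norm (h x + cnj (g x)) powr p * \<omega> x)"
    using set_integrable_norm_add_powr[OF wt op(1) _ h_cont _ int_h int_g] p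
      continuous_on_cnj[OF g_cont] by simp
  let ?C = "2 * K * B * (12 * p * K * B) powr p"
  have C: "0 \<le> ?C" using M p by (simp add: K_def B_def)
  define c where "c = h x0"
  define a where "a = weighted_average \<Omega> \<omega> h"
  have core: "n (\<lambda>z. h z - c) \<le> ?C * n (\<lambda>z. h z + cnj (g z))"
  proof -
    have nn: "(\<integral>\<^sup>+z\<in>\<Omega>. ennreal (norm (u z) powr p) \<partial>weight_measure \<omega>) = ennreal (n u)"
      if "continuous_on \<Omega> u" "set_integrable lebesgue \<Omega> (\<lambda>z. norm (u z) powr p * \<omega> z)" for u
      unfolding n_def using that p op(1)
      by (intro nn_integral_weight_measure wt borel_measurable_continuous_on_ennreal
          continuous_on_powr' continuous_intros) auto
    have nn_h: "(\<integral>\<^sup>+z\<in>\<Omega>. ennreal (norm (h z - c) powr p) \<partial>weight_measure \<omega>) = ennreal (n (\<lambda>z. h z - c))"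
      by (intro nn continuous_intros h_cont int_dev)
    have nn_f: "(\<integral>\<^sup>+z\<in>\<Omega>. ennreal (norm (h z + cnj (g z)) powr p) \<partial>weight_measure \<omega>)
        = ennreal (n (\<lambda>z. h z + cnj (g z)))"
      by (intro nn continuous_intros h_cont g_cont int_f)
    have "ennreal (n (\<lambda>z. h z - c)) \<le> ennreal ?C * ennreal (n (\<lambda>z. h z + cnj (g z)))"
      unfolding nn_h[symmetric] nn_f[symmetric] unfolding c_def B_def K_def \<kappa>_def
      by (rule holomorphic_deviation_integral_le[OF muckenhoupt_doubling[OF \<omega> q M] p op(1,3) x0 \<delta> john h(1) g(1)])
         (use nn_h in \<open>auto simp: c_def\<close>)
    then show ?thesis using C n_nonneg by (simp flip: ennreal_mult)
  qed
  have "n (\<lambda>z. h z - a) \<le> (LINT z:\<Omega>|lebesgue. 2 powr p * (norm (h z - c) powr p * \<omega> z + norm (c - a) powr p * \<omega> z))"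
    unfolding n_def
  proof (rule set_integral_mono_AE[OF int_dev])
    show "set_integrable lebesgue \<Omega> (\<lambda>z. 2 powr p * (norm (h z - c) powr p * \<omega> z + norm (c - a) powr p * \<omega> z))"
      by (intro set_integrable_mult_right set_integral_add int_dev int_const)
    show "AE z\<in>\<Omega> in lebesgue. norm (h z - a) powr p * \<omega> z
        \<le> 2 powr p * (norm (h z - c) powr p * \<omega> z + norm (c - a) powr p * \<omega> z)"
      using pos
    proof eventually_elim
      case (elim z)
      then show ?case
        using mult_right_mono[OF norm_add_powr_le[of p "h z - c" "c - a"], of "\<omega> z"] p
        by (simp add: algebra_simps)
    qed
  qed
  also have "\<dots> = 2 powr p * (n (\<lambda>z. h z - c) + norm (a - c) powr p * (LINT z:\<Omega>|lebesgue. \<omega> z))"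
    using int_dev int_const by (simp add: set_integral_add n_def norm_minus_commute)
  also have "\<dots> \<le> 2 powr p * (n (\<lambda>z. h z - c) + 2 powr p * n (\<lambda>z. h z - c))"
    using weighted_average_deviation[OF wt op(1) bdd op(2) p h_cont int_dev]
    by (intro mult_left_mono add_left_mono) (auto simp: a_def n_def)
  also have "\<dots> = 2 powr p * (1 + 2 powr p) * n (\<lambda>z. h z - c)" by (simp add: algebra_simps)
  also have "\<dots> \<le> 2 powr p * (1 + 2 powr p) * (?C * n (\<lambda>z. h z + cnj (g z)))"
    by (intro mult_left_mono core) auto
  finally have "n (\<lambda>z. h z - a) powr (1 / p)
      \<le> (2 powr p * (1 + 2 powr p) * (?C * n (\<lambda>z. h z + cnj (g z)))) powr (1 / p)"
    using p n_nonneg by (intro powr_mono2) auto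
  also have "\<dots> = (2 powr p * (1 + 2 powr p) * ?C) powr (1 / p) * n (\<lambda>z. h z + cnj (g z)) powr (1 / p)"
    using C n_nonneg by (subst powr_mult[symmetric]) (auto simp: mult.assoc)
  finally show ?thesis by (simp add: Lp a_def)
qed

section \<open>The estimate for both parts\<close>

theorem theorem2p9:
  fixes p q M \<delta> :: real
  assumes "1 \<le> p" and "1 < q" and "1 \<le> M" and "0 < \<delta>"
  shows "\<exists>C>0. \<forall>(\<omega> :: complex ^ 'n \<Rightarrow> real) (\<Omega> :: (complex ^ 'n) set) f h g.
           muckenhoupt q M \<omega> \<longrightarrow> john_domain \<delta> \<Omega> \<longrightarrow>
           pluriharmonic_on f \<Omega> \<longrightarrow> (\<forall>z\<in>\<Omega>. f z = h z + cnj (g z)) \<longrightarrow>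
           holomorphic_Cn_on h \<Omega> \<longrightarrow> holomorphic_Cn_on g \<Omega> \<longrightarrow>
           in_Lp p \<Omega> \<omega> h \<longrightarrow> in_Lp p \<Omega> \<omega> g \<longrightarrow>
           Lp_norm p \<Omega> \<omega> (\<lambda>z. h z - weighted_average \<Omega> \<omega> h)
             + Lp_norm p \<Omega> \<omega> (\<lambda>z. g z - weighted_average \<Omega> \<omega> g)
           \<le> C * Lp_norm p \<Omega> \<omega> f"
proof -
  define \<kappa> where "\<kappa> = real DIM(complex ^ 'n) * q"
  define B where "B = 2 powr p * M * (192 * 2 powr (\<kappa> / p)) powr \<kappa>"
  define K where "K = 2 * M ^ 4 * (810 * (2 / \<delta> + 1)) powr \<kappa>"
  define C where "C = (2 powr p * (1 + 2 powr p) * (2 * K * B * (12 * p * K * B) powr p)) powr (1 / p)"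
  have C: "0 \<le> C" by (simp add: C_def)
  show ?thesis
  \<comment> \<open>The summand \<open>1\<close> only makes the constant positive.\<close>
  proof (intro exI[of _ "2 * C + 1"] conjI allI impI)
    fix \<omega> :: "complex ^ 'n \<Rightarrow> real" and \<Omega> :: "(complex ^ 'n) set" and f h g
    assume \<omega>: "muckenhoupt q M \<omega>" and \<Omega>: "john_domain \<delta> \<Omega>" and f: "\<forall>z\<in>\<Omega>. f z = h z + cnj (g z)"
      and h: "holomorphic_Cn_on h \<Omega>" "in_Lp p \<Omega> \<omega> h" and g: "holomorphic_Cn_on g \<Omega>" "in_Lp p \<Omega> \<omega> g"
    note bound = holomorphic_part_Lp_norm_le[OF assms \<omega> \<Omega>, folded \<kappa>_def, folded B_def K_def, folded C_def]
    have Lp_cong: "Lp_norm p \<Omega> \<omega> u = Lp_norm p \<Omega> \<omega> f" if "\<And>z. z \<in> \<Omega> \<Longrightarrow> norm (u z) = norm (f z)" for u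
      using that \<Omega> unfolding Lp_norm_def
      by (intro arg_cong[where f = "\<lambda>x. x powr (1 / p)"] set_lebesgue_integral_cong)
        (auto simp: john_domain_def)
    \<comment> \<open>The conjugate of \<open>f\<close> is \<open>g + cnj h\<close>, so \<open>g\<close> obeys the same bound as \<open>h\<close>.\<close>
    have "norm (g z + cnj (h z)) = norm (h z + cnj (g z))" for z
      using complex_mod_cnj[of "h z + cnj (g z)"] by (simp add: add.commute)
    then have "Lp_norm p \<Omega> \<omega> (\<lambda>z. h z + cnj (g z)) = Lp_norm p \<Omega> \<omega> f"
      "Lp_norm p \<Omega> \<omega> (\<lambda>z. g z + cnj (h z)) = Lp_norm p \<Omega> \<omega> f"
      using f by (auto intro!: Lp_cong)
    then have "Lp_norm p \<Omega> \<omega> (\<lambda>z. h z - weighted_average \<Omega> \<omega> h)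
        + Lp_norm p \<Omega> \<omega> (\<lambda>z. g z - weighted_average \<Omega> \<omega> g) \<le> 2 * C * Lp_norm p \<Omega> \<omega> f"
      using bound[OF h g] bound[OF g h] by simp
    also have "\<dots> \<le> (2 * C + 1) * Lp_norm p \<Omega> \<omega> f"
      by (intro mult_right_mono) (auto simp: Lp_norm_def)
    finally show "Lp_norm p \<Omega> \<omega> (\<lambda>z. h z - weighted_average \<Omega> \<omega> h)
        + Lp_norm p \<Omega> \<omega> (\<lambda>z. g z - weighted_average \<Omega> \<omega> g) \<le> (2 * C + 1) * Lp_norm p \<Omega> \<omega> f" .
  qed (use C in simp)
qed

end
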